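(* For every odd integer $k\geq 1$ the function $g_k$ has the integral representation $$g_k(z)=\int_{\Gamma(x_k)}^{\Gamma(x_{k+1})}\frac{d_k(t)}{t-z}\,dt-k,\qquad z\in\mathbb C\setminus I_k,$$ where $I_k=[\Gamma(x_k),\Gamma(x_{k+1})]$ and $d_k(t)=\frac1\pi\,\Im g_k(t+0i)$ for $t\in I_k\setminus\{0\}$.
   Context: $\mathbb C_+$ is the open upper half plane, $\Gamma$ is Euler's gamma function and $\gamma$ Euler's constant. For $k\ge 1$, $x_k$ denotes the unique zero of $\Gamma'$ in $(-k,-k+1)$, and $x_0$ denotes the unique zero of $\Gamma'$ in $(0,\infty)$. One has $\Gamma(x_k)<0$ for $k$ odd and $\Gamma(x_k)>0$ for $k$ even. The function $\log\Gamma(z)=-\gamma z-\log z-\sum_{j=1}^\infty\left(\log(1+z/j)-z/j\right)$ (principal logarithms) is holomorphic in $\mathbb C\setminus(-\infty,0]$, and it maps $\mathbb C_+$ conformally (bijectively) onto the domain $\mathcal V=\mathbb C\setminus\bigcup_{k=0}^\infty\{x-ik\pi : x\ge\log|\Gamma(x_k)|\}$. $(\log\Gamma)^{-1}:\mathcal V\to\mathbb C_+$ denotes the inverse of this conformal map. For $k\in\mathbb Z$ put $g_k(z)=(\log\Gamma)^{-1}(\log z-i(k+1)\pi)$ for $z\in\mathbb C_+$. For odd $k\ge 1$, $I_k=[\Gamma(x_k),\Gamma(x_{k+1})]$; the function $g_k$ extends holomorphically to $\mathbb C\setminus I_k$ with $g_k(\overline z)=\overline{g_k(z)}$, and the extension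 is again denoted $g_k$. For $t\in I_k\setminus\{0\}$, $g_k(t+0i)=\lim_{y\to0+}g_k(t+iy)$. *)

theory Defs
  imports "HOL-Complex_Analysis.Complex_Analysis"
begin

abbreviation upper_half_plane :: "complex set" where
  "upper_half_plane \<equiv> {z. Im z > 0}"

definition crit_pt :: "nat \<Rightarrow> real" where
  "crit_pt k =
     (THE x. (if k = 0 then 0 < x else - real k < x \<and> x < - real k + 1) \<and> deriv Gamma x = 0)"

text \<open>
  The branch of the logarithm of the Gamma function is the library's \<open>ln_Gamma\<close>; off the
  non-positive integers it is the series of principal logarithms below.
\<close>

lemma ln_Gamma_eq_series:
  fixes z :: complex
  assumes "z \<notin> \<int>\<^sub>\<le>\<^sub>0"
  shows "ln_Gamma z = - euler_mascheroni * z - ln z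
           - (\<Sum>j. ln (1 + z / of_nat (Suc j)) - z / of_nat (Suc j))"
proof -
  have "(\<lambda>j. - (z / of_nat (Suc j) - ln (1 + z / of_nat (Suc j)))) sums
          - (ln_Gamma z + euler_mascheroni * z + ln z)"
    by (rule sums_minus[OF ln_Gamma_series'_aux[OF assms]])
  then have "(\<lambda>j. ln (1 + z / of_nat (Suc j)) - z / of_nat (Suc j)) sums
          - (ln_Gamma z + euler_mascheroni * z + ln z)"
    by (simp only: minus_diff_eq)
  from sums_unique[OF this, symmetric] show ?thesis
    by (simp only:) (simp add: algebra_simps)
qed

text \<open>
  \<open>ln_Gamma\<close> is injective on the upper half plane, with image the plane slit along the rays
  \<open>{x - i k \<pi> | x \<ge> ln \<bar>Gamma (crit_pt k)\<bar>}\<close>, so \<open>inv_into\<close> is the inverse conformal map on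
  this slit plane. It is only applied to points with imaginary part strictly between
  \<open>- (k + 1) \<pi>\<close> and \<open>- k \<pi>\<close>, which avoid all the slits.
\<close>

definition g_upper :: "int \<Rightarrow> complex \<Rightarrow> complex" where
  "g_upper k z = inv_into upper_half_plane ln_Gamma (Ln z - \<i> * of_int (k + 1) * of_real pi)"

definition cut_interval :: "nat \<Rightarrow> real set" where
  "cut_interval k = {Gamma (crit_pt k)..Gamma (crit_pt (k + 1))}"

text \<open>
  For odd \<open>k\<close>, the holomorphic extension of \<open>g_upper k\<close> to the complement of the cut. As this
  complement is connected, the extension is unique there; its values on the cut are immaterial.
\<close>

definition g_ext :: "nat \<Rightarrow> complex \<Rightarrow> complex" where
  "g_ext k = (SOME f.
     f holomorphic_on (- of_real ` cut_interval k) \<and>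
     (\<forall>z\<in>upper_half_plane. f z = g_upper (int k) z) \<and>
     (\<forall>z\<in>- of_real ` cut_interval k. f (cnj z) = cnj (f z)))"

text \<open>
  The boundary values exist at every point of the cut except \<open>0\<close>, so the value of the density
  at \<open>0\<close> is meaningless; as a single point it does not affect the integral.
\<close>

definition jump_density :: "nat \<Rightarrow> real \<Rightarrow> real" where
  "jump_density k t = Im (Lim (at_right 0) (\<lambda>y. g_ext k (of_real t + \<i> * of_real y))) / pi"

end

theory Submission
  imports Defs
begin

text \<open>
  Since \<open>Im (Digamma z) \<ge> Im z / norm z\<close> on the upper half plane, \<open>ln_Gamma\<close> is injective there and
  \<open>norm (ln_Gamma z)\<close> is at least \<open>2 * ln (norm z)\<close> up to a constant. The latter makes
  \<open>ln_Gamma\<close> a proper map on the closed upper half plane without the poles, so its image contains the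
  open strip \<open>- (k + 1) \<pi> < Im p < - k \<pi>\<close>, in which it is closed and open. The inverse extends
  continuously to the closed strip if the boundary values on the real axis are sought in
  \<open>[crit_pt (k + 1), crit_pt k]\<close> only; composed with the logarithm it is continuous on the closed upper
  half plane except at \<open>0\<close> and real off the cut, so the Schwarz reflection principle gives the extension
  \<open>g_ext k\<close>. The growth of \<open>ln_Gamma\<close>, together with the local inversion of \<open>Gamma\<close> at its pole
  \<open>- k\<close>, yields \<open>norm (g_ext k w + k) \<le> C / sqrt (norm w)\<close>. This bound is integrable at \<open>0\<close> and decays
  at infinity, so Cauchy's formula for the upper half plane holds with the boundary values on the real
  axis.
\<close>

section \<open>The logarithm of Gamma on the closed upper half plane\<close>

text \<open>The exponent in the growth bound is decisive. A lower bound a ln |z| for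
  |\<open>ln_Gamma z\<close>|, up to a constant, turns into |g(w)| <= C |w|^(-1/a) near 0, so some a
  > 1 is needed for integrable boundary values; a = 2 produces the square root. The obstacle at the
  boundary is folding. On (-m, -m+1) with m >= 1 the imaginary part of \<open>ln_Gamma\<close> is
  the constant -m pi, while ln |Gamma| takes each value above ln |Gamma (crit_pt m)| twice, so the
  real axis is folded onto the slits. The vertical derivative of Im \<open>ln_Gamma\<close> is Re
  \<open>Digamma\<close>: left of the critical point the image dips below the slit, right of it the
  image rises above. The strip below slit k and above slit k+1 therefore meets only the real points
  from \<open>crit_pt (k + 1)\<close> to \<open>crit_pt k\<close>, and the pole -k between them
  corresponds to infinity. For odd k the shift (k+1) pi is a multiple of 2 pi, so the inverse solves
  Gamma(g(w)) = w, and the negative and positive rays outside the cut match the real points to the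
  right and to the left of the pole. Adding the real number k to g leaves the density unchanged and
  makes the function vanish at infinity.\<close>

lemma ln_Gamma_plus1:
  fixes z :: complex
  assumes "z \<notin> \<int>\<^sub>\<le>\<^sub>0"
  shows "ln_Gamma (z + 1) = ln_Gamma z + Ln z"
proof -
  have z0: "z \<noteq> 0" using assms by auto
  have z1: "z + 1 \<notin> \<int>\<^sub>\<le>\<^sub>0" using assms plus_one_in_nonpos_Ints_imp by blast
  have ne: "z + of_nat k \<noteq> 0" for k
    using assms by (metis add_eq_0_iff2 minus_of_nat_in_nonpos_Ints)
  \<comment> \<open>Division by a positive real does not cross the branch cut, so the principal
    logarithm splits exactly, even on the negative axis.\<close>
  have LnS: "Ln (z / of_nat k + 1) = Ln (z + of_nat k) - of_real (ln (real k))" if "k > 0" for k :: nat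
  proof -
    have "z / of_nat k + 1 = (z + of_nat k) / of_real (real k)"
      using that by (simp add: field_simps)
    also have "Ln \<dots> = Ln (z + of_nat k) - of_real (ln (real k))"
      by (rule Ln_divide_of_real) (use that ne in auto)
    finally show ?thesis .
  qed
  have LnS': "Ln ((z + 1) / of_nat k + 1) = Ln (z + of_nat (Suc k)) - of_real (ln (real k))" if "k > 0" for k :: nat
  proof -
    have "(z + 1) / of_nat k + 1 = (z + of_nat (Suc k)) / of_real (real k)"
      using that by (simp add: field_simps)
    also have "Ln \<dots> = Ln (z + of_nat (Suc k)) - of_real (ln (real k))"
      by (rule Ln_divide_of_real) (use that ne[of "Suc k"] in auto)
    finally show ?thesis .
  qed
  \<comment> \<open>The two sums of logarithms telescope; besides \<open>Ln z\<close> there remains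
    one term, which tends to \<open>Ln 1\<close>.\<close>
  have eq: "ln_Gamma_series (z + 1) n = ln_Gamma_series z n + Ln z - Ln (z / of_nat n + (1 + 1 / of_nat n))"
    if "n > 0" for n
  proof -
    have "(\<Sum>k=1..n. Ln (z / of_nat k + 1)) - (\<Sum>k=1..n. Ln ((z + 1) / of_nat k + 1))
        = (\<Sum>k=1..n. Ln (z + of_nat k) - Ln (z + of_nat (Suc k)))"
      unfolding sum_subtractf [symmetric]
      by (rule sum.cong) (simp_all add: LnS LnS' del: of_nat_Suc)
    also have "\<dots> = Ln (z + 1) - Ln (z + of_nat (Suc n))"
      by (induction n) (auto simp: algebra_simps)
    finally have s: "(\<Sum>k=1..n. Ln (z / of_nat k + 1)) - (\<Sum>k=1..n. Ln ((z + 1) / of_nat k + 1))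
        = Ln (z + 1) - Ln (z + of_nat (Suc n))" .
    have "z / of_nat n + (1 + 1 / of_nat n) = (z + of_nat (Suc n)) / of_real (real n)"
      using that by (simp add: field_simps)
    also have "Ln \<dots> = Ln (z + of_nat (Suc n)) - of_real (ln (real n))"
      by (rule Ln_divide_of_real) (use that ne[of "Suc n"] in auto)
    finally have l: "Ln (z / of_nat n + (1 + 1 / of_nat n)) = Ln (z + of_nat (Suc n)) - of_real (ln (real n))" .
    have n: "Ln (of_nat n) = of_real (ln (real n))"
      using that Ln_of_real[of "real n"] by simp
    show ?thesis
      unfolding ln_Gamma_series_def l n using s by (simp add: algebra_simps)
  qed
  have t: "(\<lambda>n. Ln (z / of_nat n + (1 + 1 / of_nat n))) \<longlonglongrightarrow> Ln (0 + (1 + 0))"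
    by (intro tendsto_Ln tendsto_add lim_const_over_n tendsto_const) auto
  have "(\<lambda>n. ln_Gamma_series z n + Ln z - Ln (z / of_nat n + (1 + 1 / of_nat n)))
          \<longlonglongrightarrow> ln_Gamma z + Ln z - Ln (0 + (1 + 0))"
    by (intro tendsto_intros t ln_Gamma_complex_LIMSEQ assms)
  moreover have "eventually (\<lambda>n. ln_Gamma_series z n + Ln z - Ln (z / of_nat n + (1 + 1 / of_nat n))
      = ln_Gamma_series (z + 1) n) sequentially"
    using eventually_gt_at_top[of 0] by eventually_elim (simp add: eq)
  ultimately have "(\<lambda>n. ln_Gamma_series (z + 1) n) \<longlonglongrightarrow> ln_Gamma z + Ln z - Ln (0 + (1 + 0))"
    by (rule Lim_transform_eventually)
  with ln_Gamma_complex_LIMSEQ[OF z1] show ?thesis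
    using LIMSEQ_unique by fastforce
qed

text \<open>Shifting the argument to the right leaves finitely many logarithms to carry the branch
  behaviour. This gives continuity up to the real axis, the imaginary part on it, and the behaviour
  at the poles.\<close>

lemma ln_Gamma_plus_of_nat:
  fixes z :: complex
  assumes "z \<notin> \<int>\<^sub>\<le>\<^sub>0"
  shows "ln_Gamma (z + of_nat m) = ln_Gamma z + (\<Sum>j<m. Ln (z + of_nat j))"
proof (induction m)
  case (Suc m)
  have "z + of_nat m \<notin> \<int>\<^sub>\<le>\<^sub>0" using assms plus_of_nat_eq_0_imp
    by (metis add_diff_cancel_right' diff_Suc_1 nonpos_Ints_diff_Nats of_nat_in_Nats)
  from ln_Gamma_plus1[OF this] Suc show ?case by (simp add: algebra_simps)
qed auto

lemma Gamma_eq_exp_ln_Gamma: "Gamma z = exp (ln_Gamma z)" if "z \<notin> \<int>\<^sub>\<le>\<^sub>0" for z :: complex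
  using that by (simp add: Gamma_complex_altdef)

lemma Re_ln_Gamma: "Re (ln_Gamma z) = ln (norm (Gamma z))" if "z \<notin> \<int>\<^sub>\<le>\<^sub>0" for z :: complex
  using that by (simp add: Gamma_eq_exp_ln_Gamma)

lemma Ln_minus_ii_times:
  assumes "Im z \<ge> 0" "z \<noteq> 0"
  shows "Ln (- \<i> * z) = Ln z - \<i> * of_real pi / 2"
proof -
  have "0 \<le> Im (Ln z)" "Im (Ln z) \<le> pi" using assms Im_Ln_pos_le[of z] by auto
  then have "- pi < Im (Ln (- \<i>)) + Im (Ln z)" "Im (Ln (- \<i>)) + Im (Ln z) \<le> pi"
    using pi_gt_zero unfolding Ln_minus_ii by (simp_all, linarith+)
  then have "Ln (- \<i> * z) = Ln (- \<i>) + Ln z"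
    using assms by (intro Ln_times_simple) auto
  then show ?thesis by simp
qed

text \<open>The principal logarithm jumps at the negative axis only from below. Multiplication by -i
  turns the closed upper half plane into the right half plane, away from the cut.\<close>

lemma continuous_on_Ln_upper: "continuous_on ({z. Im z \<ge> 0} - {0}) Ln"
proof -
  have "continuous_on ({z. Im z \<ge> 0} - {0}) (\<lambda>z. Ln (- \<i> * z) + \<i> * of_real pi / 2)"
  proof (intro continuous_intros)
    fix z assume "z \<in> {z. Im z \<ge> 0} - {0}"
    then show "- \<i> * z \<notin> \<real>\<^sub>\<le>\<^sub>0"
      by (auto simp: complex_nonpos_Reals_iff complex_eq_iff)
  qed
  then show ?thesis
    by (rule continuous_on_eq) (use Ln_minus_ii_times in auto)
qed

text \<open>Where Re z > -m, a shift by m moves \<open>ln_Gamma\<close> into the right half plane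
  and subtracts logarithms that are continuous from above; continuity is local, so m may depend on
  the point.\<close>

lemma continuous_on_ln_Gamma_upper: "continuous_on ({z. Im z \<ge> 0} - \<int>\<^sub>\<le>\<^sub>0) (ln_Gamma :: complex \<Rightarrow> complex)"
proof -
  have c: "continuous_on ({z. Im z \<ge> 0 \<and> Re z > - real m} - \<int>\<^sub>\<le>\<^sub>0) (ln_Gamma :: complex \<Rightarrow> complex)" for m
  proof -
    let ?S = "{z. Im z \<ge> 0 \<and> Re z > - real m} - \<int>\<^sub>\<le>\<^sub>0"
    have ne: "z + of_nat j \<noteq> 0" if "z \<in> ?S" for z j
      using that by (metis DiffD2 add_eq_0_iff2 minus_of_nat_in_nonpos_Ints)
    have "continuous_on ?S (\<lambda>z. ln_Gamma (z + of_nat m) - (\<Sum>j<m. Ln (z + of_nat j)))"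
    proof (intro continuous_on_diff continuous_on_sum)
      show "continuous_on ?S (\<lambda>z. ln_Gamma (z + of_nat m) :: complex)"
        by (rule continuous_on_compose2[OF continuous_on_ln_Gamma_complex[of "{z. Re z > 0}"]])
          (auto intro!: continuous_intros simp: complex_nonpos_Reals_iff)
      show "continuous_on ?S (\<lambda>z. Ln (z + of_nat j))" for j
        by (rule continuous_on_compose2[OF continuous_on_Ln_upper])
          (auto intro!: continuous_intros simp: ne)
    qed
    then show ?thesis
      by (rule continuous_on_eq) (simp add: ln_Gamma_plus_of_nat)
  qed
  show ?thesis
    unfolding continuous_on_eq_continuous_within
  proof
    fix x :: complex assume x: "x \<in> {z. Im z \<ge> 0} - \<int>\<^sub>\<le>\<^sub>0"
    obtain m :: nat where m: "- Re x < real m" using reals_Archimedean2 by blast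
    have "continuous (at x within {z. Im z \<ge> 0 \<and> Re z > - real m} - \<int>\<^sub>\<le>\<^sub>0) ln_Gamma"
      using c[of m] x m by (auto simp: continuous_on_eq_continuous_within)
    moreover have "at x within {z. Im z \<ge> 0 \<and> Re z > - real m} - \<int>\<^sub>\<le>\<^sub>0 = at x within {z. Im z \<ge> 0} - \<int>\<^sub>\<le>\<^sub>0"
      by (rule at_within_nhd[of _ "{z. Re z > - real m}"]) (use m in \<open>auto simp: open_halfspace_Re_gt\<close>)
    ultimately show "continuous (at x within {z. Im z \<ge> 0} - \<int>\<^sub>\<le>\<^sub>0) ln_Gamma" by simp
  qed
qed

lemma Im_ln_Gamma_of_real_pos: "Im (ln_Gamma (complex_of_real x)) = 0" if "x > 0"
  using that by (simp add: ln_Gamma_complex_of_real)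

lemma of_real_between_notin_nonpos_Ints:
  assumes "- real m < x" "x < - real m + 1"
  shows "x \<notin> \<int>\<^sub>\<le>\<^sub>0" "complex_of_real x \<notin> \<int>\<^sub>\<le>\<^sub>0"
proof -
  show *: "x \<notin> \<int>\<^sub>\<le>\<^sub>0"
  proof
    assume "x \<in> \<int>\<^sub>\<le>\<^sub>0"
    then obtain n where "x = - real n" by (auto elim!: nonpos_Ints_cases')
    with assms show False by auto
  qed
  then show "complex_of_real x \<notin> \<int>\<^sub>\<le>\<^sub>0" by (simp add: of_real_in_nonpos_Ints_iff)
qed

text \<open>The shift by m leads into (0, 1), where \<open>ln_Gamma\<close> is real; each of the m
  logarithms has a negative argument and contributes pi.\<close>

lemma Im_ln_Gamma_of_real:
  assumes "- real m < x" "x < - real m + 1"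
  shows "Im (ln_Gamma (complex_of_real x)) = - real m * pi"
proof -
  have "Im (Ln (complex_of_real x + of_nat j)) = pi" if "j < m" for j
  proof -
    have "x + real j < 0" using that assms by linarith
    moreover from this have "complex_of_real x + of_nat j \<noteq> 0" by (auto simp: complex_eq_iff)
    ultimately show ?thesis by (simp add: Im_Ln_eq_pi)
  qed
  moreover have "Im (ln_Gamma (complex_of_real x + of_nat m)) = 0"
    using Im_ln_Gamma_of_real_pos[of "x + real m"] assms by simp
  ultimately show ?thesis
    using arg_cong[OF ln_Gamma_plus_of_nat[OF of_real_between_notin_nonpos_Ints(2)[OF assms], of m], of Im]
    by simp
qed

lemma real_nonpos_Int_cases:
  fixes x :: real
  assumes "x \<notin> \<int>\<^sub>\<le>\<^sub>0"
  obtains "x > 0" | m where "m > 0" "- real m < x" "x < - real m + 1"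
proof (cases "x > 0")
  case False
  have "x \<noteq> of_int \<lfloor>x\<rfloor>"
    using assms False by (metis less_eq_real_def not_less nonpos_Ints_of_int of_int_le_0_iff order.refl)
  then show ?thesis using False by (intro that(2)[of "nat (- \<lfloor>x\<rfloor>)"]) linarith+
qed (use that in auto)

section \<open>Injectivity and growth from the imaginary part of Digamma\<close>

text \<open>With r = |z|, the term -1/(z+n) of the limit formula has imaginary part Im z / |z+n|^2,
  which is at least Im z (1/(r+n) - 1/(r+n+1)). These minorants telescope to Im z / r.\<close>

lemma Im_Digamma_ge:
  assumes "Im z > 0"
  shows "Im (Digamma z) \<ge> Im z / norm z"
proof -
  define r where "r = norm z"
  have r: "r > 0" using assms unfolding r_def by auto
  have z: "z \<noteq> 0" using assms by auto
  have "(\<lambda>m. Im (of_real (ln (real m)) - (\<Sum>n<m. inverse (z + of_nat n)))) \<longlonglongrightarrow> Im (Digamma z)"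
    by (intro tendsto_intros Digamma_LIMSEQ z)
  moreover have "Im z * (1 / r - 1 / (r + real m)) \<le> Im (of_real (ln (real m)) - (\<Sum>n<m. inverse (z + of_nat n)))" for m
  proof -
    have "1 / r - 1 / (r + real m) = (\<Sum>n<m. 1 / (r + real n) - 1 / (r + real (Suc n)))"
      using sum_lessThan_telescope'[of "\<lambda>n. 1 / (r + real n)" m] by simp
    also have "Im z * \<dots> = (\<Sum>n<m. Im z * (1 / (r + real n) - 1 / (r + real (Suc n))))"
      by (simp add: sum_distrib_left)
    also have "\<dots> \<le> (\<Sum>n<m. - Im (inverse (z + of_nat n)))"
    proof (rule sum_mono)
      fix n
      have "norm (z + of_nat n) \<le> r + real n" unfolding r_def by (metis norm_of_nat norm_triangle_ineq)
      then have le: "(norm (z + of_nat n))\<^sup>2 \<le> (r + real n)\<^sup>2" by (intro power_mono) auto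
      have pos: "norm (z + of_nat n) > 0" using assms by (auto simp: complex_eq_iff)
      have "1 / (r + real n) - 1 / (r + real (Suc n)) = 1 / ((r + real n) * (r + real n + 1))"
        using r by (simp add: field_simps)
      also have "\<dots> \<le> 1 / (r + real n)\<^sup>2"
        using r by (intro divide_left_mono) (auto simp: power2_eq_square)
      also have "\<dots> \<le> 1 / (norm (z + of_nat n))\<^sup>2"
        using le pos r by (intro divide_left_mono) (auto intro!: mult_pos_pos)
      finally have "Im z * (1 / (r + real n) - 1 / (r + real (Suc n))) \<le> Im z * (1 / (norm (z + of_nat n))\<^sup>2)"
        using assms by (intro mult_left_mono) auto
      also have "\<dots> = - Im (inverse (z + of_nat n))"
        by (simp add: cmod_power2)
      finally show "Im z * (1 / (r + real n) - 1 / (r + real (Suc n))) \<le> - Im (inverse (z + of_nat n))" .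
    qed
    finally show ?thesis by (simp add: sum_negf)
  qed
  moreover have "(\<lambda>m. Im z * (1 / r - 1 / (r + real m))) \<longlonglongrightarrow> Im z * (1 / r - 0)"
    by (intro tendsto_intros tendsto_divide_0[OF tendsto_const] filterlim_at_top_imp_at_infinity
        filterlim_tendsto_add_at_top[OF tendsto_const] filterlim_real_sequentially)
  ultimately show ?thesis
    unfolding r_def[symmetric] by (intro LIMSEQ_le[of "\<lambda>m. Im z * (1 / r - 1 / (r + real m))"]) auto
qed

lemma Im_pos_notin_nonpos_Reals: "Im z > 0 \<Longrightarrow> z \<notin> \<real>\<^sub>\<le>\<^sub>0"
  by (auto simp: complex_nonpos_Reals_iff)

lemma Im_pos_notin_nonpos_Ints: "Im z > 0 \<Longrightarrow> z \<notin> \<int>\<^sub>\<le>\<^sub>0"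
  by (auto elim!: nonpos_Ints_cases')

text \<open>Writing the increment of \<open>ln_Gamma\<close> along a segment as an integral of \<open>Digamma\<close>, a lower
  bound for \<open>Im Digamma\<close> yields one for the increment divided by the increment of the argument.\<close>
lemma Im_ln_Gamma_increment_ge:
  assumes "Im z0 > 0" "Im z > 0" "z \<noteq> z0"
    and H: "\<And>s. s \<in> {0..1} \<Longrightarrow> (H has_real_derivative H' s) (at s)"
    and le: "\<And>s. s \<in> {0..1} \<Longrightarrow> H' s \<le> Im (z0 + of_real s * (z - z0)) / norm (z0 + of_real s * (z - z0))"
  shows "H 1 - H 0 \<le> Im ((ln_Gamma z - ln_Gamma z0) / (z - z0))"
proof -
  define u where "u s = z0 + of_real s * (z - z0)" for s
  define h where "h s = Im (ln_Gamma (u s) / (z - z0))" for s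
  have im: "Im (u s) > 0" if "s \<in> {0..1}" for s
  proof -
    have "Im (u s) = (1 - s) * Im z0 + s * Im z" by (simp add: u_def algebra_simps)
    also have "\<dots> > 0"
      using that assms(1,2) by (cases "s = 0") (auto intro!: add_nonneg_pos)
    finally show ?thesis .
  qed
  have h: "(h has_real_derivative Im (Digamma (u s))) (at s)" if "s \<in> {0..1}" for s
  proof -
    have "(u has_vector_derivative (z - z0)) (at s)"
      unfolding u_def by (auto intro!: derivative_eq_intros)
    from field_vector_diff_chain_at[OF this has_field_derivative_ln_Gamma_complex[OF Im_pos_notin_nonpos_Reals[OF im[OF that]]]]
    have "((\<lambda>s. ln_Gamma (u s)) has_vector_derivative (z - z0) * Digamma (u s)) (at s)"
      by (simp add: o_def)
    then have "((\<lambda>s. ln_Gamma (u s) / (z - z0)) has_vector_derivative ((z - z0) * Digamma (u s)) / (z - z0)) (at s)"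
      by (rule has_vector_derivative_divide)
    from bounded_linear.has_vector_derivative[OF bounded_linear_Im this] show ?thesis
      using assms(3) unfolding h_def has_real_derivative_iff_has_vector_derivative by simp
  qed
  have "h 0 - H 0 \<le> h 1 - H 1"
  proof (rule DERIV_nonneg_imp_nondecreasing[of 0 1 "\<lambda>s. h s - H s"])
    fix s :: real assume "0 \<le> s" "s \<le> 1"
    then have s: "s \<in> {0..1}" by auto
    show "\<exists>y. ((\<lambda>s. h s - H s) has_real_derivative y) (at s) \<and> 0 \<le> y"
      using DERIV_diff[OF h[OF s] H[OF s]] order.trans[OF le[OF s, folded u_def] Im_Digamma_ge[OF im[OF s]]]
      by (intro exI conjI) auto
  qed auto
  then show ?thesis by (simp add: h_def u_def diff_divide_distrib)
qed

text \<open>The Noshiro-Warschawski argument: on a segment in the half plane Im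
  \<open>Digamma\<close> is bounded below by the positive constant y / M, so the difference quotient
  of \<open>ln_Gamma\<close> has positive imaginary part and cannot vanish.\<close>

lemma inj_on_ln_Gamma_upper: "inj_on (ln_Gamma :: complex \<Rightarrow> complex) upper_half_plane"
proof (rule inj_onI, rule ccontr)
  fix w z :: complex
  assume *: "w \<in> upper_half_plane" "z \<in> upper_half_plane" "ln_Gamma w = ln_Gamma z" "w \<noteq> z"
  define M where "M = norm w + norm z"
  define y where "y = min (Im w) (Im z)"
  have y: "y > 0" using * by (auto simp: y_def)
  have "z \<noteq> 0" using * by auto
  then have M: "M > 0" by (simp add: M_def add_nonneg_pos)
  have "(y / M) * 1 - (y / M) * 0 \<le> Im ((ln_Gamma z - ln_Gamma w) / (z - w))"
  proof (rule Im_ln_Gamma_increment_ge)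
    fix s :: real assume s: "s \<in> {0..1}"
    show "((*) (y / M) has_real_derivative (y / M)) (at s)" by (auto intro!: derivative_eq_intros)
    define u where "u = w + of_real s * (z - w)"
    have u: "u = of_real (1 - s) * w + of_real s * z" by (simp add: u_def algebra_simps)
    have "norm u \<le> (1 - s) * norm w + s * norm z"
      unfolding u by (rule norm_triangle_le) (use s in \<open>simp add: norm_mult del: of_real_diff\<close>)
    also have "\<dots> \<le> 1 * norm w + 1 * norm z" using s by (intro add_mono mult_right_mono) auto
    finally have nu: "norm u \<le> M" by (simp add: M_def)
    have "y = (1 - s) * y + s * y" by (simp add: algebra_simps)
    also have "\<dots> \<le> (1 - s) * Im w + s * Im z"
      using s by (intro add_mono mult_left_mono) (auto simp: y_def)
    also have "\<dots> = Im u" by (simp add: u)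
    finally have iu: "y \<le> Im u" .
    then have "norm u > 0" using y by (metis Im_complex_div_gt_0 norm_eq_zero not_less zero_complex.sel(2) zero_less_norm_iff)
    then have "y / M \<le> Im u / norm u" using nu iu y M by (intro frac_le) auto
    then show "y / M \<le> Im (w + of_real s * (z - w)) / norm (w + of_real s * (z - w))"
      unfolding u_def .
  qed (use * in auto)
  with * y M show False by (simp add: field_simps)
qed

text \<open>Any starting point \<open>\<i> * M\<close> gives a lower bound \<open>(M / 2) * ln (norm z)\<close> up to a constant; only
  a factor of \<open>ln (norm z)\<close> greater than \<open>1\<close> is needed later.\<close>
lemma norm_ln_Gamma_ge_aux:
  assumes "Im z > 0" "norm z \<ge> 8"
  shows "2 * (ln (norm z / 4) - 1) \<le> norm (ln_Gamma z - ln_Gamma (4 * \<i>))"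
proof -
  define r where "r = norm z"
  have r: "r \<ge> 8" using assms by (simp add: r_def)
  have ne: "z \<noteq> 4 * \<i>" using assms by auto
  \<comment> \<open>On the segment from 4i to z one has Im u >= 4 (1-s) and |u| <= 4 + s r;
    \<open>H\<close> is a primitive of the quotient of these bounds.\<close>
  define H where "H s = (4 / r) * ((1 + 4 / r) * ln (4 + s * r) - s)" for s
  have "H 1 - H 0 \<le> Im ((ln_Gamma z - ln_Gamma (4 * \<i>)) / (z - 4 * \<i>))"
  proof (rule Im_ln_Gamma_increment_ge)
    fix s :: real assume s: "s \<in> {0..1}"
    have p: "4 + s * r > 0" using s r by (intro add_pos_nonneg) auto
    show "(H has_real_derivative 4 * (1 - s) / (4 + s * r)) (at s)"
    proof -
      have "(H has_real_derivative (4 / r) * ((1 + 4 / r) * (r / (4 + s * r)) - 1)) (at s)"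
        unfolding H_def using p r by (auto intro!: derivative_eq_intros)
      also have "(4 / r) * ((1 + 4 / r) * (r / (4 + s * r)) - 1) = 4 * (1 - s) / (4 + s * r)"
        using p r by (simp add: divide_simps) (simp add: algebra_simps)
      finally show ?thesis .
    qed
    define u where "u = 4 * \<i> + of_real s * (z - 4 * \<i>)"
    have u: "u = of_real (1 - s) * (4 * \<i>) + of_real s * z" by (simp add: u_def algebra_simps)
    have iu: "Im u = (1 - s) * 4 + s * Im z" by (simp add: u)
    have ipos: "Im u > 0"
      unfolding iu using s assms by (cases "s = 0") (auto intro!: add_nonneg_pos)
    then have "norm u > 0" by auto
    have "norm u \<le> (1 - s) * 4 + s * r"
      unfolding u by (rule norm_triangle_le) (use s in \<open>simp add: norm_mult r_def del: of_real_diff\<close>)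
    also have "\<dots> \<le> 4 + s * r" using s by simp
    finally have nu: "norm u \<le> 4 + s * r" .
    have "4 * (1 - s) / (4 + s * r) \<le> Im u / norm u"
      using nu iu ipos \<open>norm u > 0\<close> p assms(1) s by (intro frac_le) auto
    then show "4 * (1 - s) / (4 + s * r) \<le> Im (4 * \<i> + of_real s * (z - 4 * \<i>)) / norm (4 * \<i> + of_real s * (z - 4 * \<i>))"
      unfolding u_def .
  qed (use assms ne in auto)
  also have "\<dots> \<le> norm ((ln_Gamma z - ln_Gamma (4 * \<i>)) / (z - 4 * \<i>))"
    using abs_Im_le_cmod[of "(ln_Gamma z - ln_Gamma (4 * \<i>)) / (z - 4 * \<i>)"] by linarith
  \<comment> \<open>As r >= 8, the segment has length at least r - 4 >= r/2. Multiplying by r/2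
    turns the factor 4/r in \<open>H\<close> into the factor 2 of the claim.\<close>
  also have "\<dots> \<le> norm (ln_Gamma z - ln_Gamma (4 * \<i>)) / (r / 2)"
  proof -
    have "r / 2 \<le> norm (z - 4 * \<i>)"
      using norm_triangle_ineq2[of z "4 * \<i>"] r by (simp add: r_def norm_mult)
    then show ?thesis using r unfolding norm_divide by (intro frac_le) auto
  qed
  finally have 1: "(H 1 - H 0) * (r / 2) \<le> norm (ln_Gamma z - ln_Gamma (4 * \<i>))"
    using r by (simp add: field_simps)
  have "ln (4 + r) - ln 4 = ln (1 + r / 4)" using r ln_div[of "4 + r" 4] by (simp add: add_divide_distrib)
  then have "H 1 - H 0 = (4 / r) * ((1 + 4 / r) * ln (1 + r / 4) - 1)"
    unfolding H_def by (simp add: algebra_simps)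
  then have "(H 1 - H 0) * (r / 2) = 2 * ((1 + 4 / r) * ln (1 + r / 4) - 1)"
    using r by simp
  moreover have "2 * (ln (r / 4) - 1) \<le> 2 * ((1 + 4 / r) * ln (1 + r / 4) - 1)"
  proof -
    have "ln (r / 4) \<le> 1 * ln (1 + r / 4)" using r by simp
    also have "\<dots> \<le> (1 + 4 / r) * ln (1 + r / 4)" using r by (intro mult_right_mono) auto
    finally show ?thesis by (simp only: mult_le_cancel_left_pos zero_less_numeral diff_right_mono)
  qed
  ultimately have "2 * (ln (r / 4) - 1) \<le> (H 1 - H 0) * (r / 2)" by (simp only:)
  from this 1 show ?thesis unfolding r_def by (rule order.trans)
qed

lemma norm_le_exp_ln_Gamma:
  obtains C where "C > 0" "\<And>z. Im z > 0 \<Longrightarrow> norm z \<le> C * exp (norm (ln_Gamma z) / 2)"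
proof
  define K where "K = norm (ln_Gamma (4 * \<i>))"
  define C where "C = max 8 (4 * exp (K / 2 + 1))"
  show "C > 0" by (simp add: C_def)
  fix z :: complex assume z: "Im z > 0"
  show "norm z \<le> C * exp (norm (ln_Gamma z) / 2)"
  proof (cases "norm z \<ge> 8")
    case True
    have "2 * (ln (norm z / 4) - 1) \<le> norm (ln_Gamma z) + K"
      using norm_ln_Gamma_ge_aux[OF z True] norm_triangle_ineq4[of "ln_Gamma z" "ln_Gamma (4 * \<i>)"]
      unfolding K_def by linarith
    then have "ln (norm z / 4) \<le> (K / 2 + 1) + norm (ln_Gamma z) / 2" by simp
    then have "exp (ln (norm z / 4)) \<le> exp ((K / 2 + 1) + norm (ln_Gamma z) / 2)"
      by (simp only: exp_le_cancel_iff)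
    moreover have "norm z / 4 > 0" using True by linarith
    ultimately have "norm z / 4 \<le> exp ((K / 2 + 1) + norm (ln_Gamma z) / 2)"
      by (simp only: exp_ln)
    also have "\<dots> = exp (K / 2 + 1) * exp (norm (ln_Gamma z) / 2)" by (simp add: exp_add)
    finally have "norm z \<le> (4 * exp (K / 2 + 1)) * exp (norm (ln_Gamma z) / 2)" by simp
    also have "\<dots> \<le> C * exp (norm (ln_Gamma z) / 2)" by (intro mult_right_mono) (auto simp: C_def)
    finally show ?thesis .
  next
    case False
    then have "norm z \<le> 8 * 1" by simp
    also have "\<dots> \<le> C * exp (norm (ln_Gamma z) / 2)" by (intro mult_mono) (auto simp: C_def)
    finally show ?thesis .
  qed
qed

section \<open>Properness and the image of the upper half plane\<close>

lemma continuous_on_closed_upper_imp_tendsto: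
  fixes f :: "complex \<Rightarrow> complex"
  assumes "continuous_on ({z. Im z \<ge> 0} - N) f" "Im z \<ge> 0" "\<And>s. s > 0 \<Longrightarrow> z + \<i> * of_real s \<notin> N" "z \<notin> N"
  shows "((\<lambda>s. f (z + \<i> * of_real s)) \<longlongrightarrow> f z) (at_right 0)"
proof -
  have "filterlim (\<lambda>s. z + \<i> * of_real s) (at z within ({z. Im z \<ge> 0} - N)) (at_right 0)"
    unfolding filterlim_at
  proof
    have "((\<lambda>s. z + \<i> * of_real s) \<longlongrightarrow> z + \<i> * of_real 0) (at_right 0)"
      by (intro tendsto_intros)
    then show "((\<lambda>s. z + \<i> * of_real s) \<longlongrightarrow> z) (at_right 0)" by simp
    show "\<forall>\<^sub>F s in at_right 0. z + \<i> * of_real s \<in> {z. 0 \<le> Im z} - N \<and> z + \<i> * of_real s \<noteq> z"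
      using eventually_at_right_less[of "0::real"] by eventually_elim (use assms in auto)
  qed
  moreover have "(f \<longlongrightarrow> f z) (at z within ({z. Im z \<ge> 0} - N))"
    using assms by (auto simp: continuous_on)
  ultimately show ?thesis using filterlim_compose by blast
qed

text \<open>Both sides are continuous up to the real axis, so the bound survives a vertical
  limit.\<close>

lemma norm_le_exp_ln_Gamma':
  obtains C where "C > 0" "\<And>z. z \<in> {z. Im z \<ge> 0} - \<int>\<^sub>\<le>\<^sub>0 \<Longrightarrow> norm z \<le> C * exp (norm (ln_Gamma z) / 2)"
proof -
  obtain C where C: "C > 0" "\<And>z. Im z > 0 \<Longrightarrow> norm z \<le> C * exp (norm (ln_Gamma z) / 2)"
    using norm_le_exp_ln_Gamma by blast
  have "norm z \<le> C * exp (norm (ln_Gamma z) / 2)" if z: "z \<in> {z. Im z \<ge> 0} - \<int>\<^sub>\<le>\<^sub>0" for z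
  proof (rule tendsto_le)
    have "((\<lambda>s. ln_Gamma (z + \<i> * of_real s)) \<longlongrightarrow> ln_Gamma z) (at_right 0)"
      by (rule continuous_on_closed_upper_imp_tendsto[OF continuous_on_ln_Gamma_upper])
        (use z Im_pos_notin_nonpos_Ints in auto)
    then show "((\<lambda>s. C * exp (norm (ln_Gamma (z + \<i> * of_real s)) / 2)) \<longlongrightarrow> C * exp (norm (ln_Gamma z) / 2)) (at_right 0)"
      by (intro tendsto_intros) auto
    have "((\<lambda>s. norm (z + \<i> * of_real s)) \<longlongrightarrow> norm (z + \<i> * of_real 0)) (at_right 0)"
      by (intro tendsto_intros)
    then show "((\<lambda>s. norm (z + \<i> * of_real s)) \<longlongrightarrow> norm z) (at_right 0)" by simp
    show "\<forall>\<^sub>F s in at_right 0. norm (z + \<i> * of_real s) \<le> C * exp (norm (ln_Gamma (z + \<i> * of_real s)) / 2)"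
      using eventually_at_right_less[of "0::real"] by eventually_elim (use z C in auto)
  qed auto
  with C show ?thesis using that by blast
qed

text \<open>Convergent values are bounded, and by the growth bound so are their preimages. A cluster
  point cannot be a pole, because Gamma tends to infinity there while exp of the values
  converges.\<close>

lemma ln_Gamma_proper:
  fixes z :: "nat \<Rightarrow> complex"
  assumes z: "\<And>n. z n \<in> {z. Im z \<ge> 0} - \<int>\<^sub>\<le>\<^sub>0" and lim: "(\<lambda>n. ln_Gamma (z n)) \<longlonglongrightarrow> p"
  obtains r \<zeta> where "strict_mono r" "(z \<circ> r) \<longlonglongrightarrow> \<zeta>" "\<zeta> \<in> {z. Im z \<ge> 0} - \<int>\<^sub>\<le>\<^sub>0" "ln_Gamma \<zeta> = p"
proof -
  obtain C where C: "C > 0" "\<And>z. z \<in> {z. Im z \<ge> 0} - \<int>\<^sub>\<le>\<^sub>0 \<Longrightarrow> norm z \<le> C * exp (norm (ln_Gamma z) / 2)"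
    using norm_le_exp_ln_Gamma' by blast
  obtain B where B: "\<And>n. norm (ln_Gamma (z n)) \<le> B"
    using lim convergentI Bseq_def convergent_imp_Bseq by metis
  have "norm (z n) \<le> C * exp (B / 2)" for n
    using C(2)[OF z[of n]] B[of n] C(1) by (meson divide_right_mono exp_le_cancel_iff less_imp_le mult_left_mono order.trans zero_le_numeral)
  then have "bounded (range z)" by (auto simp: bounded_iff)
  then obtain \<zeta> r where r: "strict_mono r" "(z \<circ> r) \<longlonglongrightarrow> \<zeta>"
    using bounded_imp_convergent_subsequence by blast
  have im: "Im \<zeta> \<ge> 0"
    by (rule LIMSEQ_le_const[OF tendsto_Im[OF r(2)]]) (use z in auto)
  have lim': "(\<lambda>n. ln_Gamma ((z \<circ> r) n)) \<longlonglongrightarrow> p"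
    using LIMSEQ_subseq_LIMSEQ[OF lim r(1)] by (simp add: o_def)
  have notpole: "\<zeta> \<notin> \<int>\<^sub>\<le>\<^sub>0"
  proof
    assume "\<zeta> \<in> \<int>\<^sub>\<le>\<^sub>0"
    then obtain m where m: "\<zeta> = - of_nat m" by (auto elim!: nonpos_Ints_cases')
    have "filterlim (z \<circ> r) (at \<zeta>) sequentially"
      unfolding filterlim_at using r(2) z \<open>\<zeta> \<in> \<int>\<^sub>\<le>\<^sub>0\<close> by (auto intro!: always_eventually)
    then have "filterlim (\<lambda>n. Gamma ((z \<circ> r) n)) at_infinity sequentially"
      using filterlim_compose[OF Gamma_poles] m by blast
    moreover have "(\<lambda>n. exp (ln_Gamma ((z \<circ> r) n))) \<longlonglongrightarrow> exp p"
      by (intro tendsto_exp lim')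
    then have "(\<lambda>n. Gamma ((z \<circ> r) n)) \<longlonglongrightarrow> exp p"
      using z by (simp add: Gamma_eq_exp_ln_Gamma)
    ultimately show False
      using not_tendsto_and_filterlim_at_infinity sequentially_bot by blast
  qed
  have "(\<lambda>n. ln_Gamma ((z \<circ> r) n)) \<longlonglongrightarrow> ln_Gamma \<zeta>"
    by (rule continuous_on_tendsto_compose[OF continuous_on_ln_Gamma_upper r(2)])
      (use im notpole z in auto)
  with lim' have "ln_Gamma \<zeta> = p" using LIMSEQ_unique by blast
  with r im notpole show ?thesis by (intro that) auto
qed

text \<open>A small disc about \<open>\<zeta>\<close> is mapped onto a neighbourhood of the common
  value, which also catches the images of the points just above x. Injectivity would place these
  points in the disc, although their imaginary parts tend to 0.\<close>

lemma ln_Gamma_boundary_neq_interior: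
  assumes "Im \<zeta> > 0" "x \<notin> \<int>\<^sub>\<le>\<^sub>0" "Im x = 0"
  shows "ln_Gamma \<zeta> \<noteq> ln_Gamma x"
proof
  assume eq: "ln_Gamma \<zeta> = ln_Gamma x"
  define N where "N = ball \<zeta> (Im \<zeta> / 2)"
  have N: "N \<subseteq> {z. Im z > Im \<zeta> / 2}"
  proof
    fix z assume "z \<in> N"
    then have "\<bar>Im (\<zeta> - z)\<bar> < Im \<zeta> / 2" using abs_Im_le_cmod[of "\<zeta> - z"] by (auto simp: N_def dist_norm)
    moreover have "Im \<zeta> - Im z \<le> \<bar>Im (\<zeta> - z)\<bar>" by simp
    ultimately show "z \<in> {z. Im z > Im \<zeta> / 2}" by simp
  qed
  then have N': "N \<subseteq> upper_half_plane" using assms by force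
  have op: "open (ln_Gamma ` N)"
  proof (rule open_mapping_thm3)
    show "ln_Gamma holomorphic_on N" using N' Im_pos_notin_nonpos_Reals by (intro holomorphic_ln_Gamma) auto
    show "open N" by (simp add: N_def)
    show "inj_on ln_Gamma N" using inj_on_ln_Gamma_upper N' inj_on_subset by blast
  qed
  have mem: "ln_Gamma x \<in> ln_Gamma ` N" unfolding eq[symmetric] using assms by (auto simp: N_def)
  have "((\<lambda>s. ln_Gamma (x + \<i> * of_real s)) \<longlongrightarrow> ln_Gamma x) (at_right 0)"
    by (rule continuous_on_closed_upper_imp_tendsto[OF continuous_on_ln_Gamma_upper])
      (use assms Im_pos_notin_nonpos_Ints in auto)
  then have "\<forall>\<^sub>F s in at_right 0. ln_Gamma (x + \<i> * of_real s) \<in> ln_Gamma ` N"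
    by (rule topological_tendstoD[OF _ op mem])
  moreover have "\<forall>\<^sub>F s in at_right 0. s < Im \<zeta> / 2"
    using assms eventually_at_right_real[of 0 "Im \<zeta> / 2"] by (auto elim: eventually_mono)
  ultimately have "\<forall>\<^sub>F s in at_right (0::real). False"
    using eventually_at_right_less[of "0::real"]
  proof eventually_elim
    case (elim s)
    then obtain z where z: "z \<in> N" "ln_Gamma (x + \<i> * of_real s) = ln_Gamma z" by auto
    then have "x + \<i> * of_real s = z"
      using inj_on_ln_Gamma_upper N' elim assms by (auto simp: inj_on_def)
    with z N elim assms show False by force
  qed
  then show False by (simp add: trivial_limit_at_right_real)
qed

text \<open>Ensures that the image meets every strip. Just above -m + 1/2 the imaginary part is
  close to -m pi, for every m, and the image of the half plane is connected.\<close>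

lemma ln_Gamma_upper_Im_onto:
  assumes "y < 0"
  obtains z where "Im z > 0" "Im (ln_Gamma z) = y"
proof -
  have near: "\<exists>z. Im z > 0 \<and> \<bar>Im (ln_Gamma z) + real m * pi\<bar> < e" if "e > 0" for m e
  proof -
    define x where "x = - real m + 1 / 2"
    have x: "- real m < x" "x < - real m + 1" by (auto simp: x_def)
    have "((\<lambda>s. ln_Gamma (of_real x + \<i> * of_real s)) \<longlongrightarrow> ln_Gamma (of_real x)) (at_right 0)"
      by (rule continuous_on_closed_upper_imp_tendsto[OF continuous_on_ln_Gamma_upper])
        (use of_real_between_notin_nonpos_Ints[OF x] Im_pos_notin_nonpos_Ints in auto)
    from tendstoD[OF tendsto_Im[OF this] \<open>e > 0\<close>]
    have "\<forall>\<^sub>F s in at_right 0. \<bar>Im (ln_Gamma (of_real x + \<i> * of_real s)) + real m * pi\<bar> < e"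
      unfolding Im_ln_Gamma_of_real[OF x] by (simp add: dist_real_def)
    with eventually_at_right_less[of "0::real"]
    have "\<forall>\<^sub>F s in at_right (0::real). \<exists>z. Im z > 0 \<and> \<bar>Im (ln_Gamma z) + real m * pi\<bar> < e"
    proof eventually_elim
      case (elim s)
      then show ?case by (intro exI[of _ "of_real x + \<i> * of_real s"]) simp
    qed
    then show ?thesis by (simp add: trivial_limit_at_right_real)
  qed
  have conn: "connected ((\<lambda>z. Im (ln_Gamma z)) ` upper_half_plane)"
    by (intro connected_continuous_image convex_connected convex_halfspace_Im_gt continuous_intros)
      (use Im_pos_notin_nonpos_Reals in auto)
  obtain m :: nat where m: "real m > - y + 1" using reals_Archimedean2 by blast
  obtain z1 where z1: "Im z1 > 0" "\<bar>Im (ln_Gamma z1) + real m * pi\<bar> < 1" using near[of 1 m] by auto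
  obtain z2 where z2: "Im z2 > 0" "\<bar>Im (ln_Gamma z2)\<bar> < - y" using near[of "- y" 0] assms by auto
  have "real m * 1 \<le> real m * pi" using pi_gt3 by (intro mult_left_mono) auto
  then have "Im (ln_Gamma z1) \<le> y" using z1 m by linarith
  moreover have "y \<le> Im (ln_Gamma z2)" using z2 by linarith
  ultimately have "y \<in> (\<lambda>z. Im (ln_Gamma z)) ` upper_half_plane"
    using connectedD_interval[OF conn, of "Im (ln_Gamma z1)" "Im (ln_Gamma z2)" y] z1 z2 by auto
  then show ?thesis using that by auto
qed

lemma ln_Gamma_upper_onto_strip:
  assumes "- (real k + 1) * pi < Im p" "Im p < - real k * pi"
  obtains z where "Im z > 0" "ln_Gamma z = p"
proof -
  define S where "S = {z. - (real k + 1) * pi < Im z \<and> Im z < - real k * pi}"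
  have S: "open S" "connected S"
    unfolding S_def Collect_conj_eq
    by (intro open_Int open_halfspace_Im_gt open_halfspace_Im_lt)
       (intro convex_connected convex_Int convex_halfspace_Im_gt convex_halfspace_Im_lt)
  define T where "T = ln_Gamma ` upper_half_plane \<inter> S"
  have "open T" unfolding T_def
    by (intro open_Int S open_mapping_thm3 inj_on_ln_Gamma_upper open_halfspace_Im_gt holomorphic_ln_Gamma)
      (use Im_pos_notin_nonpos_Reals in auto)
  then have "openin (top_of_set S) T" using S by (auto simp: openin_open_eq T_def)
  moreover have "closedin (top_of_set S) T"
    unfolding closedin_limpt
  proof (intro conjI allI impI)
    show "T \<subseteq> S" by (auto simp: T_def)
    fix p assume p: "p islimpt T \<and> p \<in> S"
    then obtain f where f: "\<And>n. f n \<in> T" "f \<longlonglongrightarrow> p"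
      by (auto simp: islimpt_sequential)
    have "\<exists>z. Im z > 0 \<and> ln_Gamma z = f n" for n using f(1)[of n] by (auto simp: T_def)
    then obtain z where z: "\<And>n. Im (z n) > 0" "\<And>n. ln_Gamma (z n) = f n" by metis
    obtain r \<zeta> where \<zeta>: "\<zeta> \<in> {z. Im z \<ge> 0} - \<int>\<^sub>\<le>\<^sub>0" "ln_Gamma \<zeta> = p"
      by (rule ln_Gamma_proper[of z p]) (use z f Im_pos_notin_nonpos_Ints in \<open>auto simp: less_imp_le\<close>)
    \<comment> \<open>A real limit would have its value on a line Im = -m pi with m a natural
      number, and no such line lies strictly inside the strip. Hence the image is closed in the
      strip.\<close>
    have "Im \<zeta> > 0"
    proof (rule ccontr)
      assume "\<not> Im \<zeta> > 0"
      then have e: "\<zeta> = of_real (Re \<zeta>)" using \<zeta> by (auto simp: complex_eq_iff)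
      then have "Re \<zeta> \<notin> \<int>\<^sub>\<le>\<^sub>0" using \<zeta> by (metis DiffD2 of_real_in_nonpos_Ints_iff)
      then have "\<exists>m::nat. Im p = - real m * pi"
      proof (cases rule: real_nonpos_Int_cases)
        case 1 then show ?thesis using Im_ln_Gamma_of_real_pos[OF 1] e \<zeta> by (intro exI[of _ 0]) auto
      next
        case (2 m) then show ?thesis using Im_ln_Gamma_of_real[OF 2(2,3)] e \<zeta> by auto
      qed
      then obtain m where m: "Im p = - real m * pi" by auto
      have "- (real k + 1) * pi < - real m * pi" "- real m * pi < - real k * pi"
        using p unfolding S_def m[symmetric] by blast+
      then have "- (real k + 1) < - real m" "- real m < - real k"
        by (simp_all only: mult_less_cancel_right_pos[OF pi_gt_zero])
      then have "m < k + 1" "k < m" by linarith+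
      then show False by linarith
    qed
    then show "p \<in> T" using \<zeta> p by (auto simp: T_def)
  qed
  moreover have "T \<noteq> {}"
  proof -
    have "real k * pi \<ge> 0" by simp
    then have "- (real k * pi) - pi / 2 < 0" using pi_gt_zero by linarith
    then obtain z where "Im z > 0" "Im (ln_Gamma z) = - (real k * pi) - pi / 2"
      by (rule ln_Gamma_upper_Im_onto)
    moreover from this have "Im (ln_Gamma z) > - real k * pi - pi" "Im (ln_Gamma z) < - real k * pi"
      using pi_gt_zero by linarith+
    ultimately have "ln_Gamma z \<in> T" by (simp add: T_def S_def algebra_simps)
    then show ?thesis by auto
  qed
  ultimately have "T = S" using S connected_clopen by blast
  moreover have "p \<in> S" using assms unfolding S_def by blast
  ultimately have "p \<in> ln_Gamma ` upper_half_plane" unfolding T_def by blast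
  then show ?thesis using that by auto
qed

section \<open>Critical points of the real Gamma function\<close>

lemma Polygamma_1_pos: "x \<notin> \<int>\<^sub>\<le>\<^sub>0 \<Longrightarrow> Polygamma 1 x > (0::real)"
proof -
  assume x: "x \<notin> \<int>\<^sub>\<le>\<^sub>0"
  then have x0: "x \<noteq> 0" by auto
  have s: "(\<lambda>k. inverse ((x + real k)\<^sup>2)) sums Polygamma 1 x"
    using Polygamma_LIMSEQ[of x 1] x0 by (simp add: numeral_2_eq_2)
  have "0 < (\<Sum>k. inverse ((x + real k)\<^sup>2))"
    by (rule suminf_pos2[OF sums_summable[OF s], of 0]) (use x in auto)
  then show ?thesis using sums_unique[OF s] by simp
qed

lemma Digamma_strict_mono_between:
  fixes x y :: real
  assumes "- real m < x" "x < y" "y < - real m + 1"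
  shows "Digamma x < Digamma y"
proof (rule DERIV_pos_imp_increasing[OF assms(2)])
  fix t assume "x \<le> t" "t \<le> y"
  then have "t \<notin> \<int>\<^sub>\<le>\<^sub>0" using of_real_between_notin_nonpos_Ints(1)[of m t] assms by auto
  then show "\<exists>d. (Digamma has_real_derivative d) (at t) \<and> d > 0"
    using Polygamma_1_pos[of t] has_field_derivative_Polygamma[of t 0] by auto
qed

lemma deriv_Gamma_eq_0_iff:
  assumes "x \<notin> \<int>\<^sub>\<le>\<^sub>0"
  shows "deriv Gamma x = 0 \<longleftrightarrow> Digamma x = (0::real)"
proof -
  have "deriv Gamma x = Gamma x * Digamma x"
    by (intro DERIV_imp_deriv has_field_derivative_Gamma assms)
  then show ?thesis using assms by (simp add: Gamma_eq_zero_iff)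
qed

lemma rGamma_has_real_derivative: "(rGamma has_real_derivative - rGamma x * Digamma x) (at x)"
  if "x \<notin> \<int>\<^sub>\<le>\<^sub>0" for x :: real
  by (rule has_field_derivative_rGamma_no_nonpos_int[OF that])

text \<open>The poles of \<open>Gamma\<close> become zeros of \<open>rGamma\<close>, so Rolle's theorem applies on the closed interval.\<close>
lemma crit_pt_between:
  assumes "m \<ge> 1"
  shows "- real m < crit_pt m" "crit_pt m < - real m + 1" "Digamma (crit_pt m) = 0"
proof -
  have "\<exists>z. - real m < z \<and> z < - real m + 1 \<and> - rGamma z * Digamma z = 0"
  proof -
    have "rGamma (- real m) = 0" "rGamma (- real m + 1) = 0"
      using assms rGamma_eq_zero_iff[of "- real m + 1"] minus_of_nat_in_nonpos_Ints[of "m - 1", where 'a = real]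
      by (auto simp: rGamma_eq_zero_iff)
    then obtain z where z: "- real m < z" "z < - real m + 1" "(*) (- rGamma z * Digamma z) = (\<lambda>v. 0)"
      using Rolle_deriv[of "- real m" "- real m + 1" rGamma "\<lambda>x. (*) (- rGamma x * Digamma x)"]
        rGamma_has_real_derivative of_real_between_notin_nonpos_Ints(1)[of m]
      by (auto simp: has_field_derivative_def intro!: continuous_intros)
    from fun_cong[OF z(3), of 1] z show ?thesis by auto
  qed
  then obtain z where z: "- real m < z" "z < - real m + 1" "- rGamma z * Digamma z = 0" by blast
  have zn: "z \<notin> \<int>\<^sub>\<le>\<^sub>0" using of_real_between_notin_nonpos_Ints z by auto
  with z have D: "Digamma z = 0" by (simp add: rGamma_eq_zero_iff)
  have "crit_pt m = z"
    unfolding crit_pt_def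
  proof (rule the_equality)
    show "(if m = 0 then 0 < z else - real m < z \<and> z < - real m + 1) \<and> deriv Gamma z = 0"
      using z D zn assms by (simp add: deriv_Gamma_eq_0_iff)
  next
    fix x assume "(if m = 0 then 0 < x else - real m < x \<and> x < - real m + 1) \<and> deriv Gamma x = 0"
    then have x: "- real m < x" "x < - real m + 1" "deriv Gamma x = 0" using assms by auto
    then have "Digamma x = 0" using deriv_Gamma_eq_0_iff of_real_between_notin_nonpos_Ints by blast
    then show "x = z"
      using Digamma_strict_mono_between[of m x z] Digamma_strict_mono_between[of m z x] x z D
      by (cases x z rule: linorder_cases) auto
  qed
  with z D show "- real m < crit_pt m" "crit_pt m < - real m + 1" "Digamma (crit_pt m) = 0" by auto
qed

text \<open>By Rolle, equal values enclose a zero of \<open>Digamma\<close>, and strict monotonicity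
  leaves only the critical point. So Gamma is injective on either side of it.\<close>

lemma rGamma_inj_aux:
  assumes "- real m < x" "x < y" "y < - real m + 1" "rGamma x = rGamma y" "m \<ge> 1"
  shows "x < crit_pt m \<and> crit_pt m < y"
proof -
  obtain z where z: "x < z" "z < y" "(*) (- rGamma z * Digamma z) = (\<lambda>v. 0)"
    using Rolle_deriv[of x y rGamma "\<lambda>x. (*) (- rGamma x * Digamma x)"] assms
      rGamma_has_real_derivative of_real_between_notin_nonpos_Ints(1)[of m]
    by (auto simp: has_field_derivative_def intro!: continuous_intros)
  have "z \<notin> \<int>\<^sub>\<le>\<^sub>0" using of_real_between_notin_nonpos_Ints(1)[of m z] z assms by auto
  then have D: "Digamma z = 0" using fun_cong[OF z(3), of 1] by (simp add: rGamma_eq_zero_iff)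
  then have "z = crit_pt m"
    using crit_pt_between[OF assms(5)] Digamma_strict_mono_between[of m z "crit_pt m"]
      Digamma_strict_mono_between[of m "crit_pt m" z] z assms
    by (cases z "crit_pt m" rule: linorder_cases) auto
  with z show ?thesis by auto
qed

lemma Gamma_inj_between:
  assumes "- real m < x" "x < - real m + 1" "- real m < y" "y < - real m + 1"
    and "Gamma x = Gamma y" "m \<ge> 1" "x \<le> crit_pt m \<and> y \<le> crit_pt m \<or> x \<ge> crit_pt m \<and> y \<ge> crit_pt m"
  shows "x = y"
proof -
  have "rGamma x = rGamma y" using assms by (simp add: rGamma_inverse_Gamma)
  then show ?thesis
    using rGamma_inj_aux[of m x y] rGamma_inj_aux[of m y x] assms
    by (cases x y rule: linorder_cases) auto
qed

text \<open>Gamma is exp of \<open>ln_Gamma\<close>, whose imaginary part on this interval is -m pi;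
  the phase is therefore (-1)^m.\<close>

lemma Gamma_sign:
  assumes "- real m < x" "x < - real m + 1"
  shows "(-1) ^ m * Gamma x > 0"
proof -
  note n = of_real_between_notin_nonpos_Ints[OF assms]
  have "complex_of_real (Gamma x) = exp (ln_Gamma (of_real x))"
    using n by (simp add: Gamma_eq_exp_ln_Gamma flip: Gamma_complex_of_real)
  also have "\<dots> = of_real (norm (Gamma (complex_of_real x))) * cis (- real m * pi)"
    unfolding exp_eq_polar using n
    by (simp add: Im_ln_Gamma_of_real[OF assms] Re_ln_Gamma Gamma_complex_of_real Gamma_eq_zero_iff)
  also have "cis (- real m * pi) = of_real ((-1) ^ m)"
    by (simp add: complex_eq_iff)
  finally have "complex_of_real (Gamma x) = of_real (\<bar>Gamma x\<bar> * (-1) ^ m)"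
    by (simp add: Gamma_complex_of_real)
  then have "Gamma x = \<bar>Gamma x\<bar> * (-1) ^ m" unfolding of_real_eq_iff .
  then have "(-1) ^ m * Gamma x = \<bar>Gamma x\<bar>"
    by (metis minus_one_power_iff mult.commute mult_1 mult_minus1 minus_minus)
  then show ?thesis using n by (simp add: Gamma_eq_zero_iff)
qed

lemma ln_Gamma_of_real_between:
  assumes "- real m < x" "x < - real m + 1"
  shows "ln_Gamma (complex_of_real x) = of_real (ln \<bar>Gamma x\<bar>) - \<i> * of_real (real m * pi)"
proof (rule complex_eqI)
  show "Re (ln_Gamma (complex_of_real x)) = Re (of_real (ln \<bar>Gamma x\<bar>) - \<i> * of_real (real m * pi))"
    using Re_ln_Gamma[OF of_real_between_notin_nonpos_Ints(2)[OF assms]] by (simp add: Gamma_complex_of_real)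
qed (simp add: Im_ln_Gamma_of_real[OF assms])

text \<open>Tells on which side of the slit the image lies: the derivative of Im
  \<open>ln_Gamma\<close> in the vertical direction is Re \<open>Digamma\<close>, which keeps near x
  the sign recorded by \<open>\<sigma>\<close>.\<close>

lemma Im_ln_Gamma_near_real:
  assumes x: "- real m < x" "x < - real m + 1" and \<sigma>: "\<sigma> * Digamma x > (0::real)"
  obtains e where "e > 0"
    "\<And>z. norm (z - of_real x) < e \<Longrightarrow> Im z > 0 \<Longrightarrow> \<sigma> * (Im (ln_Gamma z) + real m * pi) > 0"
proof -
  note n = of_real_between_notin_nonpos_Ints[OF x]
  have x0: "x \<noteq> 0" using n by auto
  have "isCont (\<lambda>z. of_real \<sigma> * Digamma z) (complex_of_real x)"
    by (intro continuous_mult continuous_const isCont_Polygamma[OF continuous_ident n(2)])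
  moreover have "Re (of_real \<sigma> * Digamma (complex_of_real x)) > 0"
    using \<sigma> x0 by (simp add: Polygamma_of_real)
  ultimately obtain d where d: "d > 0" "\<And>z. dist z (complex_of_real x) < d \<Longrightarrow>
      dist (of_real \<sigma> * Digamma z) (of_real \<sigma> * Digamma (complex_of_real x)) < Re (of_real \<sigma> * Digamma (complex_of_real x))"
    unfolding continuous_at_eps_delta by blast
  have d': "\<sigma> * Re (Digamma z) > 0" if "norm (z - complex_of_real x) < d" for z
    using d(2)[of z] that abs_Re_le_cmod[of "of_real \<sigma> * Digamma z - of_real \<sigma> * Digamma (complex_of_real x)"]
    by (simp add: dist_norm)
  \<comment> \<open>The last two terms keep Re z between the same two poles, so that the vertical
    segment also starts from the value -m pi.\<close>
  define e where "e = min d (min (x + real m) (- real m + 1 - x))"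
  have "\<sigma> * (Im (ln_Gamma z) + real m * pi) > 0" if z: "norm (z - of_real x) < e" "Im z > 0" for z
  proof -
    define h where "h s = \<sigma> * Im (ln_Gamma (of_real (Re z) + \<i> * of_real s))" for s
    have rez: "\<bar>Re z - x\<bar> < e" using z abs_Re_le_cmod[of "z - of_real x"] by simp
    then have rz: "- real m < Re z" "Re z < - real m + 1" by (auto simp: e_def)
    have "h 0 < h (Im z)"
    proof (rule DERIV_pos_imp_increasing_open[of 0 "Im z" h])
      fix s assume s: "0 < s" "s < Im z"
      let ?w = "of_real (Re z) + \<i> * of_real s :: complex"
      have "norm (?w - of_real x) \<le> norm (z - of_real x)"
        using s unfolding cmod_def by (intro real_sqrt_le_mono add_mono) (auto simp: power_mono)
      then have D: "\<sigma> * Re (Digamma ?w) > 0" by (intro d') (use z in \<open>auto simp: e_def\<close>)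
      have "((\<lambda>s. of_real (Re z) + \<i> * of_real s) has_vector_derivative \<i>) (at s)"
        by (auto intro!: derivative_eq_intros)
      from field_vector_diff_chain_at[OF this has_field_derivative_ln_Gamma_complex]
      have "((\<lambda>s. ln_Gamma (of_real (Re z) + \<i> * of_real s)) has_vector_derivative \<i> * Digamma ?w) (at s)"
        using s Im_pos_notin_nonpos_Reals[of ?w] by (simp add: o_def)
      from bounded_linear.has_vector_derivative[OF bounded_linear_Im this]
      have "((\<lambda>s. Im (ln_Gamma (of_real (Re z) + \<i> * of_real s))) has_real_derivative Re (Digamma ?w)) (at s)"
        unfolding has_real_derivative_iff_has_vector_derivative by simp
      then have "(h has_real_derivative \<sigma> * Re (Digamma ?w)) (at s)"
        unfolding h_def by (rule DERIV_cmult)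
      with D show "\<exists>y. (h has_real_derivative y) (at s) \<and> y > 0" by blast
    next
      show "continuous_on {0..Im z} h"
        unfolding h_def
      proof (intro continuous_on_mult continuous_on_const continuous_on_Im continuous_on_compose2[OF continuous_on_ln_Gamma_upper])
        show "continuous_on {0..Im z} (\<lambda>s. of_real (Re z) + \<i> * of_real s :: complex)"
          by (intro continuous_intros)
        show "(\<lambda>s. of_real (Re z) + \<i> * of_real s) ` {0..Im z} \<subseteq> {z. Im z \<ge> 0} - \<int>\<^sub>\<le>\<^sub>0"
        proof
          fix w assume "w \<in> (\<lambda>s. of_real (Re z) + \<i> * of_real s) ` {0..Im z}"
          then obtain s where s: "s \<ge> 0" "w = of_real (Re z) + \<i> * of_real s" by auto
          then show "w \<in> {z. Im z \<ge> 0} - \<int>\<^sub>\<le>\<^sub>0"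
            using of_real_between_notin_nonpos_Ints[OF rz] Im_pos_notin_nonpos_Ints[of w]
            by (cases "s = 0") auto
        qed
      qed
    qed (use z in auto)
    then show ?thesis
      using Im_ln_Gamma_of_real[OF rz] by (simp add: h_def distrib_left flip: complex_eq)
  qed
  moreover have "e > 0" using d x by (auto simp: e_def)
  ultimately show ?thesis using that by blast
qed

section \<open>Cauchy's formula with boundary values on the real axis\<close>

text \<open>Cauchy's formula on the rectangle with base [-R, R] and height R, for f raised by
  \<open>\<epsilon>\<close> so that it is holomorphic across the base. The error is the contribution
  of the other three sides and does not depend on \<open>\<epsilon>\<close>.\<close>

lemma upper_half_plane_Cauchy_approx:
  assumes hol: "f holomorphic_on upper_half_plane"
    and bound: "\<And>w. Im w > 0 \<Longrightarrow> norm (f w) \<le> C / sqrt (norm w)"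
    and "\<epsilon> > 0" "R > 0" "Im \<zeta> \<noteq> 0" "norm \<zeta> \<le> R / 2"
  shows "norm (contour_integral (linepath (- of_real R) (of_real R)) (\<lambda>w. f (w + \<i> * of_real \<epsilon>) / (w - \<zeta>))
      - (if Im \<zeta> > 0 then 2 * pi * \<i> * f (\<zeta> + \<i> * of_real \<epsilon>) else 0)) \<le> 8 * C / sqrt R"
proof -
  define g where "g w = f (w + \<i> * of_real \<epsilon>)" for w
  define h where "h w = g w / (w - \<zeta>)" for w
  define J where "J = (if Im \<zeta> > 0 then 2 * pi * \<i> * f (\<zeta> + \<i> * of_real \<epsilon>) else 0)"
  define a1 a2 a3 a4 where "a1 = Complex (- R) 0" "a2 = Complex R 0" "a3 = Complex R R" "a4 = Complex (- R) R"
  note a = this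
  have rp: "rectpath a1 a3 = linepath a1 a2 +++ linepath a2 a3 +++ linepath a3 a4 +++ linepath a4 a1"
    by (simp add: rectpath_def a Let_def)
  \<comment> \<open>The hypothesis at a point of modulus 1 shows that \<open>C\<close> is
    nonnegative.\<close>
  have "norm (f \<i>) \<le> C" using bound[of \<i>] by simp
  then have C: "C \<ge> 0" by (rule order.trans[OF norm_ge_zero])
  have n\<zeta>: "\<bar>Re \<zeta>\<bar> < R" "\<bar>Im \<zeta>\<bar> < R"
    using abs_Re_le_cmod[of \<zeta>] abs_Im_le_cmod[of \<zeta>] assms by linarith+
  have img: "path_image (rectpath a1 a3) = cbox a1 a3 - box a1 a3"
    by (rule path_image_rectpath_cbox_minus_box) (use assms in \<open>auto simp: a\<close>)
  have holg: "g holomorphic_on {w. Im w > - \<epsilon>}"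
  proof -
    have "(f \<circ> (\<lambda>w. w + \<i> * of_real \<epsilon>)) holomorphic_on {w. Im w > - \<epsilon>}"
      by (rule holomorphic_on_compose_gen[OF _ hol]) (auto intro!: holomorphic_intros)
    then show ?thesis by (simp add: g_def[abs_def] o_def)
  qed
  have total: "(h has_contour_integral J) (rectpath a1 a3)"
  proof (cases "Im \<zeta> > 0")
    case True
    have box: "\<zeta> \<in> box a1 a3" using True n\<zeta> by (auto simp: a in_box_complex_iff)
    have "((\<lambda>w. g w / (w - \<zeta>)) has_contour_integral (2 * pi * \<i> * winding_number (rectpath a1 a3) \<zeta> * g \<zeta>)) (rectpath a1 a3)"
    proof (rule Cauchy_integral_formula_convex_simple[OF _ holg])
      show "convex {w. Im w > - \<epsilon>}" by (rule convex_halfspace_Im_gt)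
      show "\<zeta> \<in> interior {w. Im w > - \<epsilon>}"
        using True assms interior_open[OF open_halfspace_Im_gt[of "- \<epsilon>"]] by simp
      show "path_image (rectpath a1 a3) \<subseteq> {w. Im w > - \<epsilon>} - {\<zeta>}"
        unfolding img using box assms by (auto simp: a in_cbox_complex_iff)
    qed auto
    then show ?thesis using True winding_number_rectpath[OF box] by (simp add: h_def[abs_def] J_def g_def)
  next
    case False
    define S where "S = {w. Im w > max (- \<epsilon>) (Im \<zeta>)}"
    have "h holomorphic_on S" unfolding h_def
      by (intro holomorphic_intros holomorphic_on_subset[OF holg]) (auto simp: S_def)
    then have "(h has_contour_integral 0) (rectpath a1 a3)"
    proof (rule Cauchy_theorem_convex_simple)
      show "convex S" unfolding S_def by (rule convex_halfspace_Im_gt)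
      show "path_image (rectpath a1 a3) \<subseteq> S"
        unfolding img using False assms by (auto simp: a in_cbox_complex_iff S_def)
    qed auto
    then show ?thesis using False by (simp add: J_def)
  qed
  have cb: "w \<noteq> \<zeta>" "Im w > - \<epsilon>" if "w \<in> cbox a1 a3 - box a1 a3" for w
    using that n\<zeta> assms by (auto simp: a in_cbox_complex_iff in_box_complex_iff)
  have conth: "continuous_on (cbox a1 a3 - box a1 a3) h"
    unfolding h_def
    by (intro continuous_on_divide continuous_on_subset[OF holomorphic_on_imp_continuous_on[OF holg]] continuous_intros)
      (use cb in auto)
  have sub: "closed_segment a1 a2 \<subseteq> cbox a1 a3 - box a1 a3" "closed_segment a2 a3 \<subseteq> cbox a1 a3 - box a1 a3"
    "closed_segment a3 a4 \<subseteq> cbox a1 a3 - box a1 a3" "closed_segment a4 a1 \<subseteq> cbox a1 a3 - box a1 a3"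
    unfolding img[symmetric] by (auto simp: rp path_image_join)
  note int = contour_integrable_continuous_linepath[OF continuous_on_subset[OF conth]]
  note i = int[OF sub(1)] int[OF sub(2)] int[OF sub(3)] int[OF sub(4)]
  have "J = contour_integral (rectpath a1 a3) h" using contour_integral_unique[OF total] by simp
  also have "\<dots> = contour_integral (linepath a1 a2) h + (contour_integral (linepath a2 a3) h
      + (contour_integral (linepath a3 a4) h + contour_integral (linepath a4 a1) h))"
    unfolding rp using i by (simp add: contour_integrable_joinI)
  finally have J: "J = contour_integral (linepath a1 a2) h + (contour_integral (linepath a2 a3) h
      + (contour_integral (linepath a3 a4) h + contour_integral (linepath a4 a1) h))" .
  \<comment> \<open>On the three sides |f| <= C / sqrt R and |w - \<open>\<zeta>\<close>| >= R / 2;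
    their total length is 4 R, whence 8 C / sqrt R.\<close>
  define B where "B = (C / sqrt R) / (R / 2)"
  have B: "norm (h w) \<le> B" if "norm w \<ge> R" "Im w \<ge> 0" for w
  proof -
    have "(norm w)\<^sup>2 \<le> (norm (w + \<i> * of_real \<epsilon>))\<^sup>2"
      using that assms unfolding cmod_power2 by (auto intro!: power_mono)
    then have w: "R \<le> norm (w + \<i> * of_real \<epsilon>)" using that
      by (meson norm_ge_zero order.trans power2_le_imp_le)
    have "norm (g w) \<le> C / sqrt (norm (w + \<i> * of_real \<epsilon>))"
      unfolding g_def using that assms by (intro bound) auto
    also have "\<dots> \<le> C / sqrt R" using w C assms by (intro divide_left_mono mult_pos_pos) auto
    finally have 1: "norm (g w) \<le> C / sqrt R" .
    have 2: "R / 2 \<le> norm (w - \<zeta>)" using norm_triangle_ineq2[of w \<zeta>] that assms by linarith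
    show ?thesis unfolding h_def B_def norm_divide using 1 2 C assms(4) by (intro frac_le) auto
  qed
  have B0: "B \<ge> 0" using C assms by (simp add: B_def)
  have edge: "norm w \<ge> R \<and> Im w \<ge> 0"
    if "w \<in> closed_segment a2 a3 \<or> w \<in> closed_segment a3 a4 \<or> w \<in> closed_segment a4 a1" for w
  proof -
    have "\<bar>Re w\<bar> = R \<or> \<bar>Im w\<bar> = R" "Im w \<ge> 0"
      using that assms by (auto simp: a closed_segment_same_Re closed_segment_same_Im closed_segment_eq_real_ivl)
    then show ?thesis using abs_Re_le_cmod[of w] abs_Im_le_cmod[of w] by auto
  qed
  have len: "norm (a3 - a2) = R" "norm (a4 - a3) = 2 * R" "norm (a1 - a4) = R"
    using assms(4) by (auto simp: a cmod_def real_sqrt_mult)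
  have e2: "norm (contour_integral (linepath a2 a3) h) \<le> B * R"
    using has_contour_integral_bound_linepath[OF has_contour_integral_integral[OF i(2)] B0] edge B len by metis
  have e3: "norm (contour_integral (linepath a3 a4) h) \<le> B * (2 * R)"
    using has_contour_integral_bound_linepath[OF has_contour_integral_integral[OF i(3)] B0] edge B len by metis
  have e4: "norm (contour_integral (linepath a4 a1) h) \<le> B * R"
    using has_contour_integral_bound_linepath[OF has_contour_integral_integral[OF i(4)] B0] edge B len by metis
  have "norm (contour_integral (linepath a1 a2) h - J) = norm (contour_integral (linepath a2 a3) h
      + (contour_integral (linepath a3 a4) h + contour_integral (linepath a4 a1) h))"
    unfolding J by (metis add_diff_cancel_left' norm_minus_commute)
  also have "\<dots> \<le> B * R + (B * (2 * R) + B * R)"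
    using e2 e3 e4 by (intro norm_triangle_mono)
  also have "B * R + (B * (2 * R) + B * R) = 8 * C / sqrt R" using assms by (simp add: B_def field_simps)
  finally show ?thesis
  proof -
    have "a1 = - of_real R" "a2 = of_real R" by (auto simp: a complex_eq_iff)
    moreover assume "norm (contour_integral (linepath a1 a2) h - J) \<le> 8 * C / sqrt R"
    ultimately show ?thesis by (simp add: h_def[abs_def] J_def g_def)
  qed
qed

text \<open>The dominating function for the limit: the root comes from the bound on f, the other
  factor from the Cauchy kernel. On t > 0 a primitive is 2 arctan (sqrt t), which has finite limits
  at both ends.\<close>

lemma integrable_inverse_sqrt_kernel: "integrable lborel (\<lambda>t::real. 1 / (sqrt \<bar>t\<bar> * (1 + \<bar>t\<bar>)))"
proof -
  have "set_integrable lborel (einterval 0 \<infinity>) (\<lambda>t. 1 / (sqrt t * (1 + t)))"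
  proof (rule interval_integral_FTC_nonneg(1))
    show "((\<lambda>t. 2 * arctan (sqrt t)) has_real_derivative 1 / (sqrt x * (1 + x))) (at x)" if "0 < ereal x" for x
      using that by (auto intro!: derivative_eq_intros simp: inverse_eq_divide)
    show "isCont (\<lambda>t. 1 / (sqrt t * (1 + t))) x" if "0 < ereal x" for x
      using that by (auto intro!: continuous_intros)
    show "(((\<lambda>t. 2 * arctan (sqrt t)) \<circ> real_of_ereal) \<longlongrightarrow> 2 * arctan (sqrt 0)) (at_right 0)"
      unfolding zero_ereal_def ereal_tendsto_simps by (intro tendsto_intros)
    show "(((\<lambda>t. 2 * arctan (sqrt t)) \<circ> real_of_ereal) \<longlongrightarrow> 2 * (pi / 2)) (at_left \<infinity>)"
      unfolding ereal_tendsto_simps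
      by (intro tendsto_intros filterlim_compose[OF tendsto_arctan_at_top] sqrt_at_top)
  qed auto
  then have 1: "integrable lborel (\<lambda>t. indicator {0<..} t * (1 / (sqrt t * (1 + t))))"
    unfolding set_integrable_def einterval_def by (simp add: greaterThan_def)
  have 2: "integrable lborel (\<lambda>t. indicator {0<..} (- t) * (1 / (sqrt (- t) * (1 + (- t)))))"
    using 1 lborel_integrable_real_affine_iff[of "-1" "\<lambda>t. indicator {0<..} t * (1 / (sqrt t * (1 + t)))" 0] by simp
  have "(\<lambda>t::real. 1 / (sqrt \<bar>t\<bar> * (1 + \<bar>t\<bar>))) =
      (\<lambda>t. indicator {0<..} t * (1 / (sqrt t * (1 + t))) + indicator {0<..} (- t) * (1 / (sqrt (- t) * (1 + (- t)))))"
    by (rule ext) (auto simp: indicator_def)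
  then show ?thesis using Bochner_Integration.integrable_add[OF 1 2] by simp
qed

text \<open>Since the error of the rectangle formula is uniform in the shift, R can tend to infinity
  and the shift to 0 along one sequence; dominated convergence handles the integrals.\<close>

lemma upper_half_plane_Cauchy_boundary:
  assumes cont: "continuous_on ({w. Im w \<ge> 0} - {0}) f"
    and hol: "f holomorphic_on upper_half_plane"
    and bound: "\<And>w. Im w > 0 \<Longrightarrow> norm (f w) \<le> C / sqrt (norm w)"
    and \<zeta>: "Im \<zeta> \<noteq> 0"
  shows "has_bochner_integral lborel (\<lambda>t. f (of_real t) / (of_real t - \<zeta>))
     (if Im \<zeta> > 0 then 2 * pi * \<i> * f \<zeta> else 0)"
proof -
  define J where "J = (if Im \<zeta> > 0 then 2 * pi * \<i> * f \<zeta> else 0)"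
  define R where "R n = real (Suc n) + 2 * norm \<zeta>" for n
  define \<epsilon> where "\<epsilon> n = 1 / real (Suc n)" for n
  define g where "g n t = f (of_real t + \<i> * of_real (\<epsilon> n)) / (of_real t - \<zeta>)" for n t
  define s where "s n t = indicator {- R n..R n} t *\<^sub>R g n t" for n t
  have R: "R n > 0" "norm \<zeta> \<le> R n / 2" for n by (auto simp: R_def add_pos_nonneg)
  have \<epsilon>: "\<epsilon> n > 0" for n by (simp add: \<epsilon>_def)
  have "norm (f \<i>) \<le> C" using bound[of \<i>] by simp
  then have C: "C \<ge> 0" by (rule order.trans[OF norm_ge_zero])
  have ne: "of_real t - \<zeta> \<noteq> 0" for t using \<zeta> by (auto simp: complex_eq_iff)
  have contg: "continuous_on UNIV (g n)" for n
    unfolding g_def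
    by (intro continuous_on_divide continuous_on_compose2[OF holomorphic_on_imp_continuous_on[OF hol]] continuous_intros)
      (use ne \<epsilon> in auto)
  have contg': "continuous_on A (g n)" for n A using continuous_on_subset[OF contg] by blast
  have int_s: "(LINT t|lborel. s n t) = contour_integral (linepath (- of_real (R n)) (of_real (R n))) (\<lambda>w. f (w + \<i> * of_real (\<epsilon> n)) / (w - \<zeta>))" for n
  proof -
    have "(LINT t:{- R n..R n}|lborel. g n t) = integral {- R n..R n} (g n)"
      by (intro set_borel_integral_eq_integral borel_integrable_atLeastAtMost' contg')
    also have "\<dots> = contour_integral (linepath (- of_real (R n)) (of_real (R n))) (\<lambda>w. f (w + \<i> * of_real (\<epsilon> n)) / (w - \<zeta>))"
      by (subst contour_integral_linepath_Reals_eq) (use R(1)[of n] in \<open>auto simp: g_def[abs_def]\<close>)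
    finally show ?thesis by (simp add: s_def set_lebesgue_integral_def)
  qed
  have \<epsilon>0: "\<epsilon> \<longlonglongrightarrow> 0" unfolding \<epsilon>_def by (intro LIMSEQ_Suc lim_const_over_n)
  have Rtop: "filterlim R at_top sequentially"
    by (rule filterlim_at_top_mono[OF filterlim_real_sequentially]) (auto simp: R_def)
  have lim_s: "(\<lambda>n. LINT t|lborel. s n t) \<longlonglongrightarrow> J"
  proof -
    define J' where "J' n = (if Im \<zeta> > 0 then 2 * pi * \<i> * f (\<zeta> + \<i> * of_real (\<epsilon> n)) else 0)" for n
    have "J' \<longlonglongrightarrow> J"
    proof (cases "Im \<zeta> > 0")
      case True
      then have "isCont f \<zeta>"
        using holomorphic_on_imp_continuous_on[OF hol] by (simp add: continuous_on_eq_continuous_at open_halfspace_Im_gt)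
      moreover have "(\<lambda>n. \<zeta> + \<i> * of_real (\<epsilon> n)) \<longlonglongrightarrow> \<zeta> + \<i> * of_real 0" by (intro tendsto_intros \<epsilon>0)
      then have "(\<lambda>n. \<zeta> + \<i> * of_real (\<epsilon> n)) \<longlonglongrightarrow> \<zeta>" by simp
      ultimately have "(\<lambda>n. f (\<zeta> + \<i> * of_real (\<epsilon> n))) \<longlonglongrightarrow> f \<zeta>" by (rule isCont_tendsto_compose)
      then show ?thesis unfolding J'_def J_def using True by (auto intro!: tendsto_intros)
    qed (simp add: J'_def[abs_def] J_def)
    moreover have "(\<lambda>n. (LINT t|lborel. s n t) - J' n) \<longlonglongrightarrow> 0"
    proof (rule Lim_null_comparison)
      show "\<forall>\<^sub>F n in sequentially. norm ((LINT t|lborel. s n t) - J' n) \<le> 8 * C / sqrt (R n)"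
        unfolding int_s J'_def using upper_half_plane_Cauchy_approx[OF hol bound \<epsilon> R(1) \<zeta> R(2)] by simp
      show "(\<lambda>n. 8 * C / sqrt (R n)) \<longlonglongrightarrow> 0"
        by (intro tendsto_divide_0[OF tendsto_const] filterlim_at_top_imp_at_infinity filterlim_compose[OF sqrt_at_top Rtop])
    qed
    ultimately show ?thesis using tendsto_add by fastforce
  qed
  define \<eta> where "\<eta> = \<bar>Im \<zeta>\<bar>"
  \<comment> \<open>Chosen for 1 + |t| <= K |t - \<open>\<zeta>\<close>|, using |t| <= |t -
    \<open>\<zeta>\<close>| + |\<open>\<zeta>\<close>| and |t - \<open>\<zeta>\<close>| >=
    \<open>\<eta>\<close>.\<close>
  define K where "K = 1 + (norm \<zeta> + 1) / \<eta>"
  have \<eta>: "\<eta> > 0" using \<zeta> by (simp add: \<eta>_def)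
  have K: "K > 0" using \<eta> by (auto simp: K_def intro!: add_pos_nonneg)
  have kern: "1 + \<bar>t\<bar> \<le> K * norm (of_real t - \<zeta>)" for t
  proof -
    have 1: "\<eta> \<le> norm (of_real t - \<zeta>)" using abs_Im_le_cmod[of "of_real t - \<zeta>"] by (simp add: \<eta>_def)
    have "\<bar>t\<bar> \<le> norm (of_real t - \<zeta>) + norm \<zeta>" using norm_triangle_ineq[of "of_real t - \<zeta>" \<zeta>] by simp
    moreover have "(norm \<zeta> + 1) / \<eta> * \<eta> \<le> (norm \<zeta> + 1) / \<eta> * norm (of_real t - \<zeta>)"
      using 1 \<eta> by (intro mult_left_mono) auto
    moreover have "(norm \<zeta> + 1) / \<eta> * \<eta> = norm \<zeta> + 1" using \<eta> by simp
    moreover have "K * norm (of_real t - \<zeta>) = norm (of_real t - \<zeta>) + (norm \<zeta> + 1) / \<eta> * norm (of_real t - \<zeta>)"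
      by (simp only: K_def distrib_right mult_1_left)
    ultimately show ?thesis by linarith
  qed
  have AE0: "AE t in lborel. t \<noteq> (0::real)" by (rule AE_lborel_singleton)
  have dom: "norm (s n t) \<le> C * K * (1 / (sqrt \<bar>t\<bar> * (1 + \<bar>t\<bar>)))" if "t \<noteq> 0" for n t
  proof -
    let ?w = "of_real t + \<i> * of_real (\<epsilon> n) :: complex"
    \<comment> \<open>Raising the point only increases its modulus, so the bound at t dominates for
      every n.\<close>
    have "\<bar>t\<bar> \<le> norm ?w" using abs_Re_le_cmod[of ?w] by simp
    then have "C / sqrt (norm ?w) \<le> C / sqrt \<bar>t\<bar>" using that C \<epsilon>[of n] by (intro divide_left_mono mult_pos_pos) auto
    then have 1: "norm (f ?w) \<le> C / sqrt \<bar>t\<bar>" using bound[of ?w] \<epsilon>[of n] by simp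
    have 2: "inverse (norm (of_real t - \<zeta>)) \<le> K / (1 + \<bar>t\<bar>)"
      using kern[of t] ne[of t] by (simp add: field_simps add_pos_nonneg)
    have "norm (s n t) \<le> norm (g n t)" by (simp add: s_def indicator_def)
    also have "\<dots> = norm (f ?w) * inverse (norm (of_real t - \<zeta>))" unfolding g_def norm_divide by (rule divide_inverse)
    also have "\<dots> \<le> (C / sqrt \<bar>t\<bar>) * (K / (1 + \<bar>t\<bar>))" using 1 2 C by (intro mult_mono) auto
    finally show ?thesis by simp
  qed
  have lim: "(\<lambda>n. s n t) \<longlonglongrightarrow> f (of_real t) / (of_real t - \<zeta>)" if "t \<noteq> 0" for t
  proof -
    have "(\<lambda>n. of_real t + \<i> * of_real (\<epsilon> n)) \<longlonglongrightarrow> of_real t + \<i> * of_real 0" by (intro tendsto_intros \<epsilon>0)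
    then have "(\<lambda>n. f (of_real t + \<i> * of_real (\<epsilon> n))) \<longlonglongrightarrow> f (of_real t)"
      by (intro continuous_on_tendsto_compose[OF cont]) (use that \<epsilon> in \<open>auto simp: complex_eq_iff less_imp_le\<close>)
    then have "(\<lambda>n. g n t) \<longlonglongrightarrow> f (of_real t) / (of_real t - \<zeta>)"
      unfolding g_def by (intro tendsto_divide tendsto_const ne)
    moreover have "\<forall>\<^sub>F n in sequentially. g n t = s n t"
      using filterlim_at_top_dense[THEN iffD1, OF Rtop, rule_format, of "\<bar>t\<bar>"]
      by eventually_elim (auto simp: s_def indicator_def)
    ultimately show ?thesis by (rule Lim_transform_eventually)
  qed
  have meas: "(\<lambda>t. f (of_real t) / (of_real t - \<zeta>)) \<in> borel_measurable lborel"
  proof -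
    have "continuous_on (- {0}) (\<lambda>t. f (of_real t) / (of_real t - \<zeta>))"
      by (intro continuous_on_divide continuous_on_compose2[OF cont] continuous_intros) (use ne in auto)
    then show ?thesis
      using borel_measurable_continuous_countable_exceptions[of "{0}"] by simp
  qed
  have meas_s: "s n \<in> borel_measurable lborel" for n
    unfolding s_def using borel_measurable_continuous_on_indicator[OF _ contg'[of "{- R n..R n}" n]] by simp
  have w: "integrable lborel (\<lambda>t. C * K * (1 / (sqrt \<bar>t\<bar> * (1 + \<bar>t\<bar>))))"
    by (intro integrable_mult_right integrable_inverse_sqrt_kernel)
  have AElim: "AE t in lborel. (\<lambda>n. s n t) \<longlonglongrightarrow> f (of_real t) / (of_real t - \<zeta>)"
    using AE0 by eventually_elim (rule lim)
  have AEdom: "AE t in lborel. norm (s n t) \<le> C * K * (1 / (sqrt \<bar>t\<bar> * (1 + \<bar>t\<bar>)))" for n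
    using AE0 by eventually_elim (rule dom)
  note dc = integrable_dominated_convergence[OF meas meas_s w AElim AEdom]
    integral_dominated_convergence[OF meas meas_s w AElim AEdom]
  from LIMSEQ_unique[OF dc(2) lim_s] dc(1) show ?thesis by (simp add: has_bochner_integral_iff J_def)
qed

text \<open>Subtracting from Cauchy's formula at \<open>z\<close> the conjugate of the vanishing Cauchy integral at
  \<open>cnj z\<close> leaves only the imaginary part of the boundary values.\<close>
lemma upper_half_plane_Stieltjes_representation:
  assumes cont: "continuous_on ({w. Im w \<ge> 0} - {0}) f"
    and hol: "f holomorphic_on upper_half_plane"
    and bound: "\<And>w. Im w > 0 \<Longrightarrow> norm (f w) \<le> C / sqrt (norm w)"
    and z: "Im z > 0"
  shows "has_bochner_integral lborel (\<lambda>t. of_real (Im (f (of_real t)) / pi) / (of_real t - z)) (f z)"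
proof -
  have 1: "has_bochner_integral lborel (\<lambda>t. f (of_real t) / (of_real t - z)) (2 * pi * \<i> * f z)"
    using upper_half_plane_Cauchy_boundary[OF cont hol bound, of z] z by simp
  have "has_bochner_integral lborel (\<lambda>t. f (of_real t) / (of_real t - cnj z)) 0"
    using upper_half_plane_Cauchy_boundary[OF cont hol bound, of "cnj z"] z by simp
  from has_bochner_integral_bounded_linear[OF bounded_linear_cnj this]
  have 2: "has_bochner_integral lborel (\<lambda>t. cnj (f (of_real t)) / (of_real t - z)) 0" by simp
  have "has_bochner_integral lborel (\<lambda>t. (f (of_real t) / (of_real t - z) - cnj (f (of_real t)) / (of_real t - z)) / (2 * pi * \<i>))
      ((2 * pi * \<i> * f z - 0) / (2 * pi * \<i>))"
    by (intro has_bochner_integral_divide has_bochner_integral_diff 1 2)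
  moreover have "(\<lambda>t. (f (of_real t) / (of_real t - z) - cnj (f (of_real t)) / (of_real t - z)) / (2 * pi * \<i>))
      = (\<lambda>t. of_real (Im (f (of_real t)) / pi) / (of_real t - z))"
    unfolding diff_divide_distrib[symmetric] complex_diff_cnj by (simp add: mult.commute)
  ultimately show ?thesis by simp
qed

section \<open>The inverse of the logarithm of Gamma on a strip\<close>

lemma nonreal_notin_of_real_image: "Im w \<noteq> 0 \<Longrightarrow> w \<in> - of_real ` A"
  by auto

locale odd_branch =
  fixes k :: nat
  assumes odd_k: "odd k"
begin

text \<open>A part of the preimage of the closed strip on which \<open>ln_Gamma\<close> is still
  injective. Real points outside the interval between the two critical points would repeat values:
  there the image is approached from the far sides of the slits.\<close>

definition sheet :: "complex set" where
  "sheet = {z \<in> {z. Im z \<ge> 0} - \<int>\<^sub>\<le>\<^sub>0. Im (ln_Gamma z) \<in> {- (real k + 1) * pi..- real k * pi} \<and>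
         (Im z = 0 \<longrightarrow> Re z \<in> {crit_pt (k + 1)..crit_pt k})}"

definition strip_point :: "complex \<Rightarrow> complex" where
  "strip_point w = Ln w - \<i> * of_int (int k + 1) * of_real pi"

text \<open>Inverting on \<open>sheet\<close> instead of the open half plane also gives values on
  the real axis away from 0.\<close>

definition branch :: "complex \<Rightarrow> complex" where
  "branch w = inv_into sheet ln_Gamma (strip_point w)"

lemma k_ge_1: "k \<ge> 1"
  using odd_k by (cases k) auto

lemma crit_k: "- real k < crit_pt k" "crit_pt k < - real k + 1"
  using crit_pt_between[of k] k_ge_1 by auto

lemma crit_Suc_k: "- real (k + 1) < crit_pt (k + 1)" "crit_pt (k + 1) < - real (k + 1) + 1"
  using crit_pt_between[of "k + 1"] by auto

lemma Gamma_crit_k: "Gamma (crit_pt k) < 0"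
  using Gamma_sign[OF crit_k] odd_k by auto

lemma Gamma_crit_Suc_k: "Gamma (crit_pt (k + 1)) > 0"
  using Gamma_sign[OF crit_Suc_k] odd_k by auto

lemma sheet_real_cases:
  assumes "z \<in> sheet" "Im z = 0"
  obtains x where "z = of_real x" "- real k < x" "x < - real k + 1" "x \<le> crit_pt k"
  | x where "z = of_real x" "- real (k + 1) < x" "x < - real (k + 1) + 1" "x \<ge> crit_pt (k + 1)"
proof -
  have z: "z = of_real (Re z)" using assms by (auto simp: complex_eq_iff)
  have "Re z \<noteq> - real k"
  proof
    assume "Re z = - real k"
    then have "z = - of_nat k" using assms by (auto simp: complex_eq_iff)
    then show False using assms by (auto simp: sheet_def)
  qed
  moreover have "Re z \<in> {crit_pt (k + 1)..crit_pt k}" using assms by (auto simp: sheet_def)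
  ultimately show ?thesis
    using that[of "Re z"] z crit_k crit_Suc_k by (cases "Re z < - real k") auto
qed

lemma sheet_upper_or_real: "z \<in> sheet \<Longrightarrow> Im z > 0 \<or> Im z = 0"
  by (auto simp: sheet_def)

text \<open>Interior points are separated by injectivity in the half plane, interior from real ones
  by the open mapping argument, the two sides of the pole -k by the imaginary parts -k pi and -(k+1)
  pi, and points on one side by injectivity of Gamma between pole and critical point.\<close>

lemma inj_on_ln_Gamma_sheet: "inj_on ln_Gamma sheet"
proof (rule inj_onI)
  fix u v assume uv: "u \<in> sheet" "v \<in> sheet" "ln_Gamma u = ln_Gamma v"
  have n: "u \<notin> \<int>\<^sub>\<le>\<^sub>0" "v \<notin> \<int>\<^sub>\<le>\<^sub>0" using uv by (auto simp: sheet_def)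
  have 1: "u = v" if "Im u > 0" "Im v > 0"
    using that uv inj_on_ln_Gamma_upper by (auto simp: inj_on_def)
  have 2: False if "Im u > 0" "Im v = 0"
    using ln_Gamma_boundary_neq_interior[of u v] that uv n by auto
  have 3: False if "Im u = 0" "Im v > 0"
    using ln_Gamma_boundary_neq_interior[of v u] that uv n by auto
  have 4: "u = v" if im: "Im u = 0" "Im v = 0"
  proof -
    have Geq: "Gamma u = Gamma v" using uv n by (simp add: Gamma_eq_exp_ln_Gamma)
    have pi: "- real k * pi \<noteq> - real (k + 1) * pi" by (simp only: mult_cancel_right) simp
    show ?thesis
    proof (rule sheet_real_cases[OF uv(1) im(1)]; rule sheet_real_cases[OF uv(2) im(2)])
      fix x y assume *: "u = of_real x" "- real k < x" "x < - real k + 1" "x \<le> crit_pt k"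
        "v = of_real y" "- real k < y" "y < - real k + 1" "y \<le> crit_pt k"
      then have "Gamma x = Gamma y" using Geq by (simp add: Gamma_complex_of_real)
      then show ?thesis using Gamma_inj_between[of k x y] * k_ge_1 by auto
    next
      fix x y assume *: "u = of_real x" "- real k < x" "x < - real k + 1" "x \<le> crit_pt k"
        "v = of_real y" "- real (k + 1) < y" "y < - real (k + 1) + 1" "y \<ge> crit_pt (k + 1)"
      from Im_ln_Gamma_of_real[OF *(2,3)] Im_ln_Gamma_of_real[OF *(6,7)] uv(3) pi *(1,5)
      show ?thesis by metis
    next
      fix x y assume *: "u = of_real x" "- real (k + 1) < x" "x < - real (k + 1) + 1" "x \<ge> crit_pt (k + 1)"
        "v = of_real y" "- real k < y" "y < - real k + 1" "y \<le> crit_pt k"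
      from Im_ln_Gamma_of_real[OF *(2,3)] Im_ln_Gamma_of_real[OF *(6,7)] uv(3) pi *(1,5)
      show ?thesis by metis
    next
      fix x y assume *: "u = of_real x" "- real (k + 1) < x" "x < - real (k + 1) + 1" "x \<ge> crit_pt (k + 1)"
        "v = of_real y" "- real (k + 1) < y" "y < - real (k + 1) + 1" "y \<ge> crit_pt (k + 1)"
      then have "Gamma x = Gamma y" using Geq by (simp add: Gamma_complex_of_real)
      then show ?thesis using Gamma_inj_between[of "k + 1" x y] * by auto
    qed
  qed
  show "u = v" using 1 2 3 4 sheet_upper_or_real[OF uv(1)] sheet_upper_or_real[OF uv(2)] by blast
qed

text \<open>Beyond properness, a real limit must lie between the critical points. Its value in the
  closed strip leaves only the intervals on either side of -k, and past a critical point nearby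
  interior images lie outside the strip.\<close>

lemma sheet_closed:
  assumes z: "\<And>n::nat. z n \<in> sheet" and lim: "(\<lambda>n. ln_Gamma (z n)) \<longlonglongrightarrow> p"
  obtains r \<zeta> where "strict_mono r" "(z \<circ> r) \<longlonglongrightarrow> \<zeta>" "\<zeta> \<in> sheet" "ln_Gamma \<zeta> = p"
proof -
  obtain r \<zeta> where r: "strict_mono r" "(z \<circ> r) \<longlonglongrightarrow> \<zeta>" "\<zeta> \<in> {z. Im z \<ge> 0} - \<int>\<^sub>\<le>\<^sub>0" "ln_Gamma \<zeta> = p"
    by (rule ln_Gamma_proper[of z p, OF _ lim]) (use z in \<open>auto simp: sheet_def\<close>)
  have im: "Im p \<in> {- (real k + 1) * pi..- real k * pi}"
    by (rule closed_sequentially[OF _ _ tendsto_Im[OF lim]]) (use z in \<open>auto simp: sheet_def\<close>)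
  have "Re \<zeta> \<in> {crit_pt (k + 1)..crit_pt k}" if "Im \<zeta> = 0"
  proof -
    define x where "x = Re \<zeta>"
    have \<zeta>: "\<zeta> = of_real x" using that by (simp add: x_def complex_eq_iff)
    then have "x \<notin> \<int>\<^sub>\<le>\<^sub>0" using r by (auto simp: of_real_in_nonpos_Ints_iff)
    then have ex: "\<exists>m. (m = k \<or> m = k + 1) \<and> - real m < x \<and> x < - real m + 1"
    proof (cases rule: real_nonpos_Int_cases)
      case 1
      then have "Im p = 0" using Im_ln_Gamma_of_real_pos[OF 1] r \<zeta> by auto
      moreover have "real k * pi > 0" using k_ge_1 by simp
      ultimately show ?thesis using im by auto
    next
      case (2 m)
      then have "Im p = - real m * pi" using Im_ln_Gamma_of_real[OF 2(2,3)] r \<zeta> by auto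
      then have "- (real k + 1) \<le> - real m" "- real m \<le> - real k"
        using im unfolding atLeastAtMost_iff by (simp_all only: mult_le_cancel_right_pos[OF pi_gt_zero])
      then have "m = k \<or> m = k + 1" by auto
      with 2 show ?thesis by blast
    qed
    \<comment> \<open>Supplies a member of the sequence close to x. With e the distance to the
      critical point, it is excluded from \<open>sheet\<close> by its real part if real, and by the
      sign of the imaginary part if not.\<close>
    have near: "\<exists>z\<in>sheet. norm (z - of_real x) < e \<and> (Im z > 0 \<longrightarrow> \<sigma> * (Im (ln_Gamma z) + real m * pi) > 0)"
      if h: "- real m < x" "x < - real m + 1" "\<sigma> * Digamma x > 0" "e > 0" for m \<sigma> e
    proof -
      obtain d where d: "d > 0"
        "\<And>z. norm (z - of_real x) < d \<Longrightarrow> Im z > 0 \<Longrightarrow> \<sigma> * (Im (ln_Gamma z) + real m * pi) > 0"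
        by (rule Im_ln_Gamma_near_real[OF h(1-3)]) blast
      have "min e d > 0" using d \<open>e > 0\<close> by simp
      from tendstoD[OF r(2) this] obtain n where "norm (z (r n) - of_real x) < min e d"
        unfolding \<zeta> by (auto simp: dist_norm eventually_sequentially)
      then show ?thesis using z d(2) by (intro bexI[of _ "z (r n)"]) auto
    qed
    from ex consider "- real k < x" "x < - real k + 1" | "- real (k + 1) < x" "x < - real (k + 1) + 1" by blast
    then have "x \<in> {crit_pt (k + 1)..crit_pt k}"
    proof cases
      case 1
      have "\<not> x > crit_pt k"
      proof
        assume gt: "x > crit_pt k"
        then have "1 * Digamma x > 0"
          using Digamma_strict_mono_between[of k "crit_pt k" x] crit_pt_between[OF k_ge_1] 1 by simp
        from near[OF 1 this, of "x - crit_pt k"] gt obtain z where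
          "z \<in> sheet" "norm (z - of_real x) < x - crit_pt k" "Im z > 0 \<Longrightarrow> 1 * (Im (ln_Gamma z) + real k * pi) > 0"
          by auto
        then show False
          using abs_Re_le_cmod[of "z - of_real x"] by (auto simp: sheet_def)
      qed
      then show ?thesis using 1 crit_Suc_k by auto
    next
      case 2
      have "\<not> x < crit_pt (k + 1)"
      proof
        assume lt: "x < crit_pt (k + 1)"
        then have "(-1) * Digamma x > 0"
          using Digamma_strict_mono_between[of "k + 1" x "crit_pt (k + 1)"] crit_pt_between[of "k + 1"] 2 by simp
        from near[OF 2 this, of "crit_pt (k + 1) - x"] lt obtain z where
          "z \<in> sheet" "norm (z - of_real x) < crit_pt (k + 1) - x"
          "Im z > 0 \<Longrightarrow> (-1) * (Im (ln_Gamma z) + real (k + 1) * pi) > 0"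
          by auto
        then show False
          using abs_Re_le_cmod[of "z - of_real x"] by (auto simp: sheet_def algebra_simps)
      qed
      then show ?thesis using 2 crit_k by auto
    qed
    then show ?thesis by (simp add: x_def)
  qed
  then have "\<zeta> \<in> sheet" using r im by (auto simp: sheet_def)
  with r show ?thesis using that by blast
qed

lemma sheet_onto_open:
  assumes "- (real k + 1) * pi < Im p" "Im p < - real k * pi"
  shows "p \<in> ln_Gamma ` sheet"
proof -
  obtain z where z: "Im z > 0" "ln_Gamma z = p" by (rule ln_Gamma_upper_onto_strip[OF assms])
  then have "z \<in> sheet" using assms Im_pos_notin_nonpos_Ints[of z] by (auto simp: sheet_def)
  with z show ?thesis by (intro image_eqI) simp_all
qed

text \<open>A point on the edge of the strip is a limit of interior points, moved towards the
  midline \<open>c\<close> with weight 1/(n+2), strictly between 0 and 1; their preimages accumulate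
  in \<open>sheet\<close>.\<close>

lemma sheet_onto:
  assumes "- (real k + 1) * pi \<le> Im p" "Im p \<le> - real k * pi"
  shows "p \<in> ln_Gamma ` sheet"
proof -
  define c where "c = - (real k + 1 / 2) * pi"
  define q where "q n = p + \<i> * of_real ((c - Im p) / real (Suc n + 1))" for n
  have "\<exists>z. z \<in> sheet \<and> ln_Gamma z = q n" for n
  proof -
    define t where "t = 1 / real (Suc n + 1)"
    have t: "0 < t" "t < 1" by (auto simp: t_def)
    have cc: "- (real k + 1) * pi < c" "c < - real k * pi"
      unfolding c_def by (simp_all only: mult_less_cancel_right_pos[OF pi_gt_zero])
    have iq: "Im (q n) = (1 - t) * Im p + t * c" by (simp add: q_def t_def algebra_simps diff_divide_distrib)
    have "- (real k + 1) * pi = (1 - t) * (- (real k + 1) * pi) + t * (- (real k + 1) * pi)" by algebra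
    also have "\<dots> < (1 - t) * Im p + t * c"
      using t assms cc by (intro add_le_less_mono mult_left_mono mult_strict_left_mono) auto
    finally have 1: "- (real k + 1) * pi < Im (q n)" unfolding iq .
    have "(1 - t) * Im p + t * c < (1 - t) * (- real k * pi) + t * (- real k * pi)"
      using t assms cc by (intro add_le_less_mono mult_left_mono mult_strict_left_mono) auto
    also have "\<dots> = - real k * pi" by algebra
    finally have 2: "Im (q n) < - real k * pi" unfolding iq .
    show ?thesis using sheet_onto_open[OF 1 2] by auto
  qed
  then obtain z where z: "\<And>n. z n \<in> sheet" "\<And>n. ln_Gamma (z n) = q n" by metis
  have "(\<lambda>n. p + \<i> * of_real ((c - Im p) / real (Suc (Suc n)))) \<longlonglongrightarrow> p + \<i> * of_real 0"
    by (intro tendsto_intros LIMSEQ_Suc[OF LIMSEQ_Suc[OF lim_const_over_n]])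
  then have "(\<lambda>n. ln_Gamma (z n)) \<longlonglongrightarrow> p" unfolding z q_def by simp
  from sheet_closed[OF z(1) this] obtain \<zeta> where "\<zeta> \<in> sheet" "ln_Gamma \<zeta> = p" by metis
  then show ?thesis by (intro image_eqI) simp_all
qed

lemma Im_strip_point: "Im (strip_point w) = Im (Ln w) - (real k + 1) * pi"
  by (simp add: strip_point_def)

lemma strip_point_strip:
  assumes "Im w \<ge> 0" "w \<noteq> 0"
  shows "- (real k + 1) * pi \<le> Im (strip_point w)" "Im (strip_point w) \<le> - real k * pi"
proof -
  have "0 \<le> Im (Ln w)" "Im (Ln w) \<le> pi" using assms Im_Ln_pos_le[of w] by auto
  moreover have "(real k + 1) * pi = real k * pi + pi" "- (real k + 1) * pi = - ((real k + 1) * pi)"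
    "- real k * pi = - (real k * pi)"
    by (simp_all add: algebra_simps)
  ultimately show "- (real k + 1) * pi \<le> Im (strip_point w)" "Im (strip_point w) \<le> - real k * pi"
    unfolding Im_strip_point by linarith+
qed

lemma branch_in:
  assumes "Im w \<ge> 0" "w \<noteq> 0"
  shows "branch w \<in> sheet" "ln_Gamma (branch w) = strip_point w"
  unfolding branch_def
  by (rule inv_into_into[OF sheet_onto[OF strip_point_strip[OF assms]]], rule f_inv_into_f[OF sheet_onto[OF strip_point_strip[OF assms]]])

lemma branch_eqI:
  assumes "z \<in> sheet" "ln_Gamma z = strip_point w"
  shows "branch w = z"
  unfolding branch_def using inv_into_f_eq[OF inj_on_ln_Gamma_sheet assms] .

lemma Im_ln_Gamma_real_sheet:
  assumes "z \<in> sheet" "Im z = 0"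
  shows "Im (ln_Gamma z) = - real k * pi \<or> Im (ln_Gamma z) = - (real k + 1) * pi"
proof (rule sheet_real_cases[OF assms])
  fix x assume "z = of_real x" "- real k < x" "x < - real k + 1"
  then show ?thesis using Im_ln_Gamma_of_real[of k x] by blast
next
  fix x assume *: "z = of_real x" "- real (k + 1) < x" "x < - real (k + 1) + 1"
  have "real k + 1 = real (k + 1)" by simp
  with Im_ln_Gamma_of_real[OF *(2,3)] *(1) show ?thesis by metis
qed

text \<open>Real points of \<open>sheet\<close> have values on the edges of the strip, whereas 0 <
  Im (Ln w) < pi puts \<open>strip_point w\<close> strictly inside.\<close>

lemma branch_upper:
  assumes "Im w > 0"
  shows "Im (branch w) > 0"
proof (rule ccontr)
  assume "\<not> Im (branch w) > 0"
  moreover have w: "w \<noteq> 0" using assms by auto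
  ultimately have "Im (branch w) = 0" using sheet_upper_or_real[OF branch_in(1)[of w]] assms by auto
  then have "Im (strip_point w) = - real k * pi \<or> Im (strip_point w) = - (real k + 1) * pi"
    using Im_ln_Gamma_real_sheet[of "branch w"] branch_in[of w] assms w by auto
  moreover have "0 < Im (Ln w)" "Im (Ln w) < pi" using Im_Ln_pos_lt[OF w] assms by blast+
  moreover have "(real k + 1) * pi = real k * pi + pi" "- (real k + 1) * pi = - ((real k + 1) * pi)"
    "- real k * pi = - (real k * pi)"
    by (simp_all add: algebra_simps)
  ultimately show False unfolding Im_strip_point by linarith
qed

lemma g_upper_eq_branch:
  assumes "Im w > 0"
  shows "g_upper (int k) w = branch w"
proof -
  have "w \<noteq> 0" using assms by auto
  then show ?thesis
    unfolding g_upper_def strip_point_def[symmetric]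
    by (intro inv_into_f_eq[OF inj_on_ln_Gamma_upper]) (use assms branch_upper[OF assms] branch_in[of w] in auto)
qed

lemma holomorphic_on_branch: "branch holomorphic_on upper_half_plane"
proof -
  obtain g where g: "g holomorphic_on (ln_Gamma ` upper_half_plane)"
    "\<And>z. z \<in> upper_half_plane \<Longrightarrow> g (ln_Gamma z) = z"
    by (rule holomorphic_has_inverse[OF _ open_halfspace_Im_gt inj_on_ln_Gamma_upper])
      (auto intro!: holomorphic_ln_Gamma dest: Im_pos_notin_nonpos_Reals)
  have strip_point: "strip_point w = ln_Gamma (branch w)" "branch w \<in> upper_half_plane" if "w \<in> upper_half_plane" for w
    using branch_in(2)[of w] branch_upper[of w] that by force+
  have "strip_point holomorphic_on upper_half_plane"
    unfolding strip_point_def by (intro holomorphic_intros) (auto dest: Im_pos_notin_nonpos_Reals)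
  then have "(g \<circ> strip_point) holomorphic_on upper_half_plane"
    by (rule holomorphic_on_compose_gen[OF _ g(1)]) (use strip_point in auto)
  then show ?thesis
    by (rule holomorphic_transform) (use strip_point g in auto)
qed

lemma continuous_on_strip_point: "continuous_on ({z. Im z \<ge> 0} - {0}) strip_point"
  unfolding strip_point_def by (intro continuous_on_diff continuous_on_Ln_upper continuous_on_const)

text \<open>A subsequence of values staying away from \<open>branch a\<close> would still accumulate
  at a point of \<open>sheet\<close> over \<open>strip_point a\<close>, and injectivity identifies
  that point with \<open>branch a\<close>.\<close>

lemma continuous_on_branch: "continuous_on ({z. Im z \<ge> 0} - {0}) branch"
  unfolding continuous_on_sequentially
proof (intro allI ballI impI, elim conjE)
  fix x a assume a: "a \<in> {z. Im z \<ge> 0} - {0}" and x: "\<forall>n. x n \<in> {z. Im z \<ge> 0} - {0}" and lim: "x \<longlonglongrightarrow> a"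
  have inD: "branch (x n) \<in> sheet" "ln_Gamma (branch (x n)) = strip_point (x n)" for n using branch_in[of "x n"] x by auto
  have Plim: "(\<lambda>n. strip_point (x n)) \<longlonglongrightarrow> strip_point a"
    by (rule continuous_on_tendsto_compose[OF continuous_on_strip_point lim]) (use x a in auto)
  show "(branch \<circ> x) \<longlonglongrightarrow> branch a"
  proof (rule ccontr)
    assume "\<not> (branch \<circ> x) \<longlonglongrightarrow> branch a"
    then obtain e where e: "e > 0" "\<And>N. \<exists>n\<ge>N. dist (branch (x n)) (branch a) \<ge> e"
      unfolding lim_sequentially by (auto simp: not_less)
    then have "infinite {n. dist (branch (x n)) (branch a) \<ge> e}"
      unfolding infinite_nat_iff_unbounded_le by auto
    then obtain s :: "nat \<Rightarrow> nat" where s: "strict_mono s" "\<And>n. dist (branch (x (s n))) (branch a) \<ge> e"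
      using infinite_enumerate by (metis mem_Collect_eq)
    have "(\<lambda>n. ln_Gamma (branch (x (s n)))) \<longlonglongrightarrow> strip_point a"
      using LIMSEQ_subseq_LIMSEQ[OF Plim s(1)] by (simp add: inD o_def)
    then obtain r \<zeta> where r: "((\<lambda>n. branch (x (s n))) \<circ> r) \<longlonglongrightarrow> \<zeta>" "\<zeta> \<in> sheet" "ln_Gamma \<zeta> = strip_point a"
      using sheet_closed[of "\<lambda>n. branch (x (s n))" "strip_point a"] inD by metis
    then have "branch a = \<zeta>" by (intro branch_eqI)
    then have "eventually (\<lambda>n. dist (branch (x (s (r n)))) (branch a) < e) sequentially"
      using tendstoD[OF r(1) e(1)] by simp
    then show False using s(2) by (auto simp: eventually_sequentially not_le[symmetric])
  qed
qed

text \<open>Here the parity of k enters: Gamma is negative on the interval right of -k, where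
  \<open>Ln\<close> adds i pi and reaches the line -k pi, and positive left of -k, where the line is
  -(k+1) pi.\<close>

lemma branch_of_real_eqI:
  assumes "- real m < x" "x < - real m + 1" "m = k \<and> x \<le> crit_pt k \<or> m = k + 1 \<and> x \<ge> crit_pt (k + 1)"
  shows "branch (of_real (Gamma x)) = of_real x"
proof (rule branch_eqI)
  note n = of_real_between_notin_nonpos_Ints[OF assms(1,2)]
  note sg = Gamma_sign[OF assms(1,2)]
  show "complex_of_real x \<in> sheet"
    using assms n crit_k crit_Suc_k Im_ln_Gamma_of_real[OF assms(1,2)] by (auto simp: sheet_def algebra_simps)
  show "ln_Gamma (complex_of_real x) = strip_point (of_real (Gamma x))"
  proof (cases "Gamma x > 0")
    case True
    then have "m = k + 1" using assms(3) sg odd_k by auto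
    with True show ?thesis
      by (simp add: ln_Gamma_of_real_between[OF assms(1,2)] strip_point_def Ln_of_real)
  next
    case False
    then have "Gamma x < 0" "m = k" using assms(3) sg odd_k by auto
    moreover have "Ln (complex_of_real (Gamma x)) = of_real (ln \<bar>Gamma x\<bar>) + \<i> * of_real pi"
      using \<open>Gamma x < 0\<close> by (simp add: Ln_of_real')
    ultimately show ?thesis
      by (simp add: ln_Gamma_of_real_between[OF assms(1,2)] strip_point_def algebra_simps)
  qed
qed

text \<open>Outside the cut, t is a value of Gamma between the pole -k and a critical point. The
  intermediate value theorem is applied to \<open>rGamma\<close> and 1/t, since
  \<open>rGamma\<close> is continuous at the pole and vanishes there.\<close>

lemma branch_real:
  assumes "t \<notin> cut_interval k"
  shows "Im (branch (of_real t)) = 0"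
proof -
  have *: "Im (branch (of_real t)) = 0" if "rGamma x = 1 / t" "t \<noteq> 0" "- real m \<le> x" "x \<le> - real m + 1"
     "m = k \<and> x \<le> crit_pt k \<or> m = k + 1 \<and> x \<ge> crit_pt (k + 1)" for x m
  proof -
    have Geq: "Gamma x = t" using that(1,2) by (simp add: rGamma_inverse_Gamma field_simps)
    have "- real m + 1 = - real (m - 1)" using that(5) k_ge_1 by (auto simp: of_nat_diff)
    then have "- real m \<in> \<int>\<^sub>\<le>\<^sub>0" "- real m + 1 \<in> \<int>\<^sub>\<le>\<^sub>0"
      using minus_of_nat_in_nonpos_Ints[of m, where 'a = real] minus_of_nat_in_nonpos_Ints[of "m - 1", where 'a = real]
      by metis+
    \<comment> \<open>\<open>Gamma\<close> is 0 at its poles by convention, whereas t is not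
      0.\<close>
    then have "x \<noteq> - real m" "x \<noteq> - real m + 1"
      using that(2) Geq Gamma_nonpos_Int[of x] by auto
    then show ?thesis using branch_of_real_eqI[of m x] that Geq by auto
  qed
  have pole: "rGamma (- real k) = 0" by (simp add: rGamma_eq_zero_iff)
  consider "t < Gamma (crit_pt k)" | "t > Gamma (crit_pt (k + 1))"
    using assms by (auto simp: cut_interval_def)
  then show ?thesis
  proof cases
    case 1
    then have "t < 0" using Gamma_crit_k by linarith
    have "\<exists>x. - real k \<le> x \<and> x \<le> crit_pt k \<and> rGamma x = 1 / t"
    proof (rule IVT2')
      show "rGamma (crit_pt k) \<le> 1 / t"
        unfolding rGamma_inverse_Gamma using le_imp_inverse_le_neg[OF less_imp_le[OF 1] Gamma_crit_k]
        by (simp add: inverse_eq_divide)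
      show "1 / t \<le> rGamma (- real k)" using pole \<open>t < 0\<close> by simp
    qed (use crit_k in \<open>auto intro!: continuous_intros\<close>)
    then obtain x where x: "- real k \<le> x" "x \<le> crit_pt k" "rGamma x = 1 / t" by blast
    show ?thesis using *[OF x(3) _ x(1)] x(2) crit_k \<open>t < 0\<close> by simp
  next
    case 2
    then have "t > 0" using Gamma_crit_Suc_k by linarith
    have "\<exists>x. crit_pt (k + 1) \<le> x \<and> x \<le> - real k \<and> rGamma x = 1 / t"
    proof (rule IVT2')
      show "1 / t \<le> rGamma (crit_pt (k + 1))"
        unfolding rGamma_inverse_Gamma using le_imp_inverse_le[OF less_imp_le[OF 2] Gamma_crit_Suc_k]
        by (simp add: inverse_eq_divide)
      show "rGamma (- real k) \<le> 1 / t" using pole \<open>t > 0\<close> by simp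
    qed (use crit_Suc_k in \<open>auto intro!: continuous_intros\<close>)
    then obtain x where x: "crit_pt (k + 1) \<le> x" "x \<le> - real k" "rGamma x = 1 / t" by blast
    show ?thesis using *[OF x(3), of "k + 1"] x crit_Suc_k \<open>t > 0\<close> by simp
  qed
qed

section \<open>Growth of the inverse\<close>

lemma zero_in_cut: "0 \<in> cut_interval k"
  using Gamma_crit_k Gamma_crit_Suc_k by (auto simp: cut_interval_def)

lemma open_compl_cut: "open (- complex_of_real ` cut_interval k)"
  unfolding cut_interval_def
  by (intro open_Compl compact_imp_closed compact_continuous_image continuous_intros) auto

text \<open>\<open>g_ext\<close> is a choice, so its properties need a witness:
  \<open>branch\<close> above the axis and its reflection below. The singular point 0 of
  \<open>branch\<close> lies on the cut.\<close>

lemma g_ext_spec: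
  "g_ext k holomorphic_on (- of_real ` cut_interval k)"
  "\<And>z. Im z > 0 \<Longrightarrow> g_ext k z = branch z"
  "\<And>z. z \<in> - of_real ` cut_interval k \<Longrightarrow> g_ext k (cnj z) = cnj (g_ext k z)"
proof -
  let ?S = "- complex_of_real ` cut_interval k"
  define f where "f z = (if 0 \<le> Im z then branch z else cnj (branch (cnj z)))" for z
  have z0: "z \<noteq> 0" if "z \<in> ?S" for z using that zero_in_cut by force
  have real: "Im (branch z) = 0" if "z \<in> ?S" "Im z = 0" for z
  proof -
    have z: "z = of_real (Re z)" using that by (simp add: complex_eq_iff)
    then have "Re z \<notin> cut_interval k" using that by (metis ComplD imageI)
    from branch_real[OF this] z show ?thesis by simp
  qed
  have 1: "f holomorphic_on ?S"
    unfolding f_def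
  proof (rule Schwarz_reflection[OF open_compl_cut])
    show "cnj ` ?S \<subseteq> ?S"
      by (auto simp: image_iff) (metis complex_cnj_cnj complex_cnj_complex_of_real)
    show "branch holomorphic_on ?S \<inter> {z. 0 < Im z}" by (rule holomorphic_on_subset[OF holomorphic_on_branch]) auto
    show "continuous_on (?S \<inter> {z. 0 \<le> Im z}) branch"
      by (rule continuous_on_subset[OF continuous_on_branch]) (use z0 in auto)
    show "branch z \<in> \<real>" if "z \<in> ?S" "z \<in> \<real>" for z
      using real[of z] that by (auto simp: complex_is_Real_iff)
  qed
  have 2: "f z = g_upper (int k) z" if "z \<in> upper_half_plane" for z
    using that g_upper_eq_branch by (simp add: f_def)
  have 3: "f (cnj z) = cnj (f z)" if "z \<in> ?S" for z
  proof (cases "Im z = 0")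
    case True
    then have "cnj z = z" by (simp add: complex_eq_iff)
    moreover have "cnj (branch z) = branch z" using real[OF that True] by (simp add: complex_eq_iff)
    ultimately show ?thesis using True by (simp add: f_def)
  qed (auto simp: f_def)
  have "\<exists>f. f holomorphic_on ?S \<and> (\<forall>z\<in>upper_half_plane. f z = g_upper (int k) z) \<and> (\<forall>z\<in>?S. f (cnj z) = cnj (f z))"
    using 1 2 3 by blast
  from someI_ex[OF this, folded g_ext_def]
  have "g_ext k holomorphic_on ?S" "\<forall>z\<in>upper_half_plane. g_ext k z = g_upper (int k) z"
    "\<forall>z\<in>?S. g_ext k (cnj z) = cnj (g_ext k z)" by blast+
  then show "g_ext k holomorphic_on ?S" "\<And>z. Im z > 0 \<Longrightarrow> g_ext k z = branch z"
    "\<And>z. z \<in> ?S \<Longrightarrow> g_ext k (cnj z) = cnj (g_ext k z)"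
    using g_upper_eq_branch by auto
qed

text \<open>Above the axis \<open>g_ext\<close> is \<open>branch\<close>, which is continuous up to
  every real t other than 0, so the vertical limit is its value there.\<close>

lemma jump_density_eq:
  assumes "t \<noteq> 0"
  shows "jump_density k t = Im (branch (of_real t)) / pi"
proof -
  have "((\<lambda>y. branch (of_real t + \<i> * of_real y)) \<longlongrightarrow> branch (of_real t)) (at_right 0)"
    by (rule continuous_on_closed_upper_imp_tendsto[OF continuous_on_branch]) (use assms in \<open>auto simp: complex_eq_iff\<close>)
  moreover have "\<forall>\<^sub>F y in at_right 0. branch (of_real t + \<i> * of_real y) = g_ext k (of_real t + \<i> * of_real y)"
    using eventually_at_right_less[of "0::real"] by eventually_elim (simp add: g_ext_spec)
  ultimately have "((\<lambda>y. g_ext k (of_real t + \<i> * of_real y)) \<longlongrightarrow> branch (of_real t)) (at_right 0)"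
    by (rule Lim_transform_eventually)
  then have "Lim (at_right 0) (\<lambda>y. g_ext k (of_real t + \<i> * of_real y)) = branch (of_real t)"
    by (rule tendsto_Lim[rotated]) (rule trivial_limit_at_right_real)
  then show ?thesis by (simp add: jump_density_def)
qed

section \<open>Bounds near zero and near infinity\<close>

text \<open>|\<open>strip_point w\<close>| exceeds |ln |w|| by at most the bounded amount
  \<open>K\<close>. The result has order |w|^(-1/2) near 0 and |w|^(1/2) near infinity, so infinity
  needs a separate argument.\<close>

lemma norm_branch_le:
  obtains C where "C > 0" "\<And>w. Im w \<ge> 0 \<Longrightarrow> w \<noteq> 0 \<Longrightarrow> norm (branch w) \<le> C * exp (\<bar>ln (norm w)\<bar> / 2)"
proof -
  obtain C where C: "C > 0" "\<And>z. z \<in> {z. Im z \<ge> 0} - \<int>\<^sub>\<le>\<^sub>0 \<Longrightarrow> norm z \<le> C * exp (norm (ln_Gamma z) / 2)"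
    using norm_le_exp_ln_Gamma' by blast
  define K where "K = pi + (real k + 1) * pi"
  show ?thesis
  proof (rule that[of "C * exp (K / 2)"])
    show "C * exp (K / 2) > 0" using C by simp
    fix w assume w: "Im w \<ge> 0" "w \<noteq> 0"
    have "norm (Ln w) \<le> \<bar>Re (Ln w)\<bar> + \<bar>Im (Ln w)\<bar>" by (rule cmod_le)
    also have "\<dots> \<le> \<bar>ln (norm w)\<bar> + pi" using w mpi_less_Im_Ln[of w] Im_Ln_le_pi[of w] by simp
    finally have 1: "norm (Ln w) \<le> \<bar>ln (norm w)\<bar> + pi" .
    have "norm (strip_point w) \<le> norm (Ln w) + norm (\<i> * of_int (int k + 1) * of_real pi)"
      unfolding strip_point_def by (rule norm_triangle_ineq4)
    also have "norm (\<i> * of_int (int k + 1) * complex_of_real pi) = (real k + 1) * pi"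
      unfolding norm_mult norm_of_int by simp
    finally have 2: "norm (strip_point w) / 2 \<le> K / 2 + \<bar>ln (norm w)\<bar> / 2" using 1 by (simp add: K_def field_simps)
    have "norm (branch w) \<le> C * exp (norm (strip_point w) / 2)"
      using C(2)[of "branch w"] branch_in[OF w] by (auto simp: sheet_def)
    also have "\<dots> \<le> C * exp (K / 2 + \<bar>ln (norm w)\<bar> / 2)" using C 2 by (intro mult_left_mono) auto
    finally show "norm (branch w) \<le> C * exp (K / 2) * exp (\<bar>ln (norm w)\<bar> / 2)" by (simp add: exp_add)
  qed
qed

text \<open>After a shift by m + 1, the m logarithms on the cut are replaced by those of -(z + j),
  continuous at -m, at a cost of pi each. The term \<open>Ln (z + of_nat m)\<close> has imaginary
  part in (0, pi) and the rest, \<open>?h\<close>, is near 0. The window is coarse, but parity will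
  complete the argument.\<close>

lemma Im_ln_Gamma_near_pole:
  "\<forall>\<^sub>F z in nhds (- of_nat m). Im z > 0 \<longrightarrow> Im (ln_Gamma z) \<in> {- (real m + 2) * pi<..<- (real m - 1) * pi}"
proof -
  let ?h = "\<lambda>z :: complex. Im (ln_Gamma (z + of_nat (m + 1)) - (\<Sum>j<m. Ln (- (z + of_nat j))))"
  have val: "?h (- of_nat m) = 0"
  proof -
    have "Im (Ln (of_nat m - complex_of_nat j)) = 0" if "j < m" for j
    proof -
      have "of_nat m - complex_of_nat j = of_real (real m - real j)" by simp
      also have "Im (Ln \<dots>) = 0" using that by (subst Ln_of_real) auto
      finally show ?thesis .
    qed
    moreover have "ln_Gamma (1::complex) = 0" using ln_Gamma_complex_of_real[of 1] by (simp add: ln_Gamma_real_pos)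
    ultimately show ?thesis by simp
  qed
  have "isCont ?h (- of_nat m)"
    by (intro continuous_Im continuous_diff continuous_sum isCont_ln_Gamma_complex isCont_Ln'
        continuous_minus continuous_add continuous_ident continuous_const)
      (auto simp: complex_nonpos_Reals_iff)
  then have "(?h \<longlongrightarrow> ?h (- of_nat m)) (nhds (- of_nat m))" unfolding isCont_def tendsto_nhds_iff by blast
  then have "(?h \<longlongrightarrow> 0) (nhds (- of_nat m))" unfolding val .
  from tendstoD[OF this pi_gt_zero] show ?thesis
  proof eventually_elim
    case (elim z)
    show ?case
    proof
      assume z: "Im z > 0"
      have ne: "z + of_nat j \<noteq> 0" for j :: nat using z by (metis Im_complex_of_real add_cancel_right_right less_irrefl of_real_of_nat_eq plus_complex.sel(2) zero_complex.sel(2))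
      have "Ln (z + of_nat j) = Ln (- (z + of_nat j)) + \<i> * of_real pi" for j :: nat
        using Ln_minus[OF ne[of j]] z by simp
      then have "ln_Gamma (z + of_nat (m + 1)) = ln_Gamma z + ((\<Sum>j<m. Ln (- (z + of_nat j)) + \<i> * of_real pi) + Ln (z + of_nat m))"
        unfolding ln_Gamma_plus_of_nat[OF Im_pos_notin_nonpos_Ints[OF z], of "m + 1"] by simp
      then have "ln_Gamma z = ln_Gamma (z + of_nat (m + 1)) - (\<Sum>j<m. Ln (- (z + of_nat j))) - of_nat m * (\<i> * of_real pi) - Ln (z + of_nat m)"
        by (simp add: sum.distrib algebra_simps)
      then have "Im (ln_Gamma z) = ?h z - real m * pi - Im (Ln (z + of_nat m))" by simp
      moreover have "\<bar>?h z\<bar> < pi" using elim by (simp add: dist_real_def)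
      ultimately obtain a where a: "Im (ln_Gamma z) = a - real m * pi - Im (Ln (z + of_nat m))" "\<bar>a\<bar> < pi" by blast
      have "0 < Im (Ln (z + of_nat m))" "Im (Ln (z + of_nat m)) < pi"
        using Im_Ln_pos_lt[OF ne[of m]] z by simp_all
      then have "- (real m * pi) - 2 * pi < Im (ln_Gamma z)" "Im (ln_Gamma z) < - (real m * pi) + pi"
        using a by linarith+
      then show "Im (ln_Gamma z) \<in> {- (real m + 2) * pi<..<- (real m - 1) * pi}"
        by (simp add: algebra_simps)
    qed
  qed
qed

text \<open>Near infinity, \<open>branch\<close> is the local inverse of \<open>Gamma\<close> at its pole \<open>- k\<close>, as \<open>rGamma\<close> is
  locally invertible there.\<close>
lemma norm_branch_plus_k_le:
  obtains R where "R \<ge> 1" "\<And>w. Im w > 0 \<Longrightarrow> norm w > R \<Longrightarrow> norm (branch w + of_nat k) \<le> 2 / norm w"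
proof -
  let ?p = "- of_nat k :: complex"
  have D0: "(rGamma has_field_derivative (-1) ^ k * fact k) (at ?p)"
    by (rule has_field_derivative_rGamma_nonpos_int)
  have zero: "rGamma ?p = 0" by (simp add: rGamma_eq_zero_iff)
  have "((\<lambda>z. rGamma z / (z - ?p)) \<longlongrightarrow> (-1) ^ k * fact k) (at ?p)"
    using D0 zero unfolding has_field_derivative_iff by simp
  from order_tendstoD(1)[OF tendsto_norm[OF this], of "1 / 2"]
  \<comment> \<open>The limit has modulus k! >= 1, so 1/2 is a safe lower bound; its reciprocal is
    the constant 2 of the claim.\<close>
  have e1: "\<forall>\<^sub>F z in at ?p. norm (rGamma z / (z - ?p)) > 1 / 2"
    using fact_ge_1[of k, where 'a = real] by (simp add: norm_mult norm_power)
  have "isCont (deriv rGamma) ?p"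
    using holomorphic_on_imp_continuous_on[OF holomorphic_deriv[OF holomorphic_rGamma[of UNIV] open_UNIV]]
    by (simp add: continuous_on_eq_continuous_at)
  then have "((\<lambda>z. Re (deriv rGamma z)) \<longlongrightarrow> Re (deriv rGamma ?p)) (nhds ?p)"
    by (intro tendsto_Re) (simp add: isCont_def tendsto_nhds_iff)
  moreover have "Re (deriv rGamma ?p) < 0"
  proof -
    have "(-1) ^ k * fact k = complex_of_real (- fact k)" using odd_k by (simp add: minus_one_power_iff)
    then show ?thesis unfolding DERIV_imp_deriv[OF D0] by (simp del: of_real_minus)
  qed
  ultimately have e2: "\<forall>\<^sub>F z in nhds ?p. Re (deriv rGamma z) < 0"
    by (rule order_tendstoD(2))
  from e1[unfolded eventually_at_filter] e2 Im_ln_Gamma_near_pole[of k]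
  have "\<forall>\<^sub>F z in nhds ?p. (z \<noteq> ?p \<longrightarrow> norm (rGamma z / (z - ?p)) > 1 / 2) \<and> Re (deriv rGamma z) < 0 \<and>
      (Im z > 0 \<longrightarrow> Im (ln_Gamma z) \<in> {- (real k + 2) * pi<..<- (real k - 1) * pi})"
    by eventually_elim auto
  then obtain d where d: "d > 0" and dd: "\<And>z. dist z ?p < d \<Longrightarrow> z \<noteq> ?p \<Longrightarrow> norm (rGamma z / (z - ?p)) > 1 / 2"
      "\<And>z. dist z ?p < d \<Longrightarrow> Re (deriv rGamma z) < 0"
      "\<And>z. dist z ?p < d \<Longrightarrow> Im z > 0 \<Longrightarrow> Im (ln_Gamma z) \<in> {- (real k + 2) * pi<..<- (real k - 1) * pi}"
    unfolding eventually_nhds_metric by blast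
  have half: "norm (z + of_nat k) \<le> 2 * norm (rGamma z)" if "dist z ?p < d" for z
  proof (cases "z = ?p")
    case False
    then have "z + of_nat k \<noteq> 0" by (metis add_eq_0_iff2)
    then show ?thesis using dd(1)[OF that False] by (simp add: norm_divide field_simps)
  qed (simp add: zero)
  \<comment> \<open>For odd k the derivative of \<open>rGamma\<close> at -k is negative, so Im
    \<open>rGamma\<close> decreases upwards from 0 on the real axis. Hence the preimage of 1/w with
    Im w > 0 lies in the upper half plane.\<close>
  have neg: "Im (rGamma z) < 0" if z: "dist z ?p < d" "Im z > 0" for z
  proof -
    define h where "h s = Im (rGamma (of_real (Re z) + \<i> * of_real s))" for s
    have "h (Im z) < h 0"
    proof (rule DERIV_neg_imp_decreasing[of 0 "Im z" h])
      fix s assume s: "0 \<le> s" "s \<le> Im z"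
      let ?w = "of_real (Re z) + \<i> * of_real s :: complex"
      have "norm (?w - ?p) \<le> norm (z - ?p)"
        using s unfolding cmod_def by (intro real_sqrt_le_mono add_mono) (auto simp: power_mono)
      then have dneg: "Re (deriv rGamma ?w) < 0" using z by (intro dd(2)) (auto simp: dist_norm)
      have "((\<lambda>s. of_real (Re z) + \<i> * of_real s) has_vector_derivative \<i>) (at s)"
        by (auto intro!: derivative_eq_intros)
      from field_vector_diff_chain_at[OF this holomorphic_derivI[OF holomorphic_rGamma[of UNIV] open_UNIV]]
      have "((\<lambda>s. rGamma (of_real (Re z) + \<i> * of_real s)) has_vector_derivative \<i> * deriv rGamma ?w) (at s)"
        by (simp add: o_def)
      from bounded_linear.has_vector_derivative[OF bounded_linear_Im this]
      have "(h has_real_derivative Re (deriv rGamma ?w)) (at s)"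
        unfolding h_def has_real_derivative_iff_has_vector_derivative by simp
      with dneg show "\<exists>y. (h has_real_derivative y) (at s) \<and> y < 0" by blast
    qed (use z in auto)
    moreover have "h 0 = 0" by (simp add: h_def rGamma_complex_of_real)
    ultimately show ?thesis by (simp add: h_def flip: complex_eq)
  qed
  \<comment> \<open>By the open mapping theorem a disc about 0 is covered, so 1/w has a preimage
    near -k once |w| > 1/e.\<close>
  have "open (rGamma ` ball ?p d)"
  proof (rule open_mapping_thm[of rGamma UNIV])
    show "\<not> (rGamma :: complex \<Rightarrow> complex) constant_on UNIV"
      unfolding constant_on_def using zero rGamma_1 by (metis UNIV_I zero_neq_one)
  qed (auto intro: holomorphic_rGamma)
  moreover have "0 \<in> rGamma ` ball ?p d" using zero d by (auto intro!: image_eqI[of _ _ ?p])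
  ultimately obtain e where e: "e > 0" "ball 0 e \<subseteq> rGamma ` ball ?p d"
    unfolding open_contains_ball by blast
  show ?thesis
  proof (rule that[of "max 1 (1 / e)"])
    fix w assume w: "Im w > 0" "norm w > max 1 (1 / e)"
    then have w0: "w \<noteq> 0" by auto
    have "norm (inverse w) < e" using w e(1) w0 unfolding norm_inverse by (simp add: field_simps)
    then have "inverse w \<in> rGamma ` ball ?p d" using e by auto
    then obtain z where z: "dist z ?p < d" "rGamma z = inverse w" by (auto simp: dist_commute)
    have iw: "Im (inverse w) < 0" using w w0 by (simp add: divide_neg_pos sum_power2_gt_zero_iff complex_eq_iff)
    have imz: "Im z > 0"
    proof (rule ccontr)
      assume "\<not> Im z > 0"
      then consider "Im z = 0" | "Im (cnj z) > 0" by fastforce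
      then show False
      proof cases
        case 1
        then have "z = of_real (Re z)" by (simp add: complex_eq_iff)
        then have "Im (rGamma z) = 0" by (metis rGamma_complex_of_real Im_complex_of_real)
        then show False using iw unfolding z(2) by linarith
      next
        case 2
        have "dist (cnj z) ?p = dist z ?p"
          using complex_mod_cnj[of "z - ?p"] by (simp add: dist_norm)
        then have "Im (rGamma (cnj z)) < 0" using neg[of "cnj z"] 2 z by simp
        moreover have "Im (rGamma (cnj z)) = - Im (inverse w)"
          unfolding cnj_rGamma[symmetric] z(2) by (simp only: cnj.sel)
        ultimately show False using iw by linarith
      qed
    qed
    have "Gamma z = w" using z(2) by (simp add: rGamma_inverse_Gamma)
    then have "exp (ln_Gamma z) = exp (Ln w)"
      using Gamma_eq_exp_ln_Gamma[OF Im_pos_notin_nonpos_Ints[OF imz]] w0 by simp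
    then obtain n :: int where n: "ln_Gamma z = Ln w + (of_int (2 * n) * pi) * \<i>"
      unfolding exp_eq by blast
    have L: "0 < Im (Ln w)" "Im (Ln w) < pi" using Im_Ln_pos_lt[OF w0] w by blast+
    have I: "Im (ln_Gamma z) = Im (Ln w) + of_int (2 * n) * pi" by (simp add: n)
    have "- (real k + 2) * pi < Im (Ln w) + of_int (2 * n) * pi"
      "Im (Ln w) + of_int (2 * n) * pi < - (real k - 1) * pi"
      using dd(3)[OF z(1) imz] by (simp_all add: I)
    then have "- (real k + 3) * pi < of_int (2 * n) * pi" "of_int (2 * n) * pi < - (real k - 1) * pi"
      using L by (simp_all add: algebra_simps)
    then have "- (real k + 3) < of_int (2 * n)" "of_int (2 * n) < - (real k - 1)"
      by (simp_all only: mult_less_cancel_right_pos[OF pi_gt_zero])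
    then have "- (int k + 3) < 2 * n" "2 * n < - (int k - 1)" by linarith+
    \<comment> \<open>The even number 2n lies strictly between -(k+3) and -(k-1), which are even for
      odd k; only -(k+1) remains.\<close>
    with odd_k have "2 * n = - (int k + 1)" by presburger
    then have n': "(of_int (2 * n) :: complex) = of_int (- (int k + 1))" by (simp only:)
    have "complex_of_real (real_of_int (2 * n) * pi) = - (of_int (int k + 1) * of_real pi)"
      unfolding of_real_mult of_real_of_int_eq n' of_int_minus mult_minus_left ..
    then have "ln_Gamma z = strip_point w" unfolding n strip_point_def by simp
    moreover have "z \<in> sheet"
      using imz Im_pos_notin_nonpos_Ints[OF imz] strip_point_strip[of w] w w0 calculation by (auto simp: sheet_def)
    ultimately have "branch w = z" by (intro branch_eqI)
    then show "norm (branch w + of_nat k) \<le> 2 / norm w"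
      using half[OF z(1)] unfolding z(2) norm_inverse by (simp add: divide_inverse)
  qed auto
qed

text \<open>For |w| <= 1 the factor exp (|ln |w|| / 2) is exactly 1 / sqrt |w|; on 1 <= |w| <= R
  everything is bounded; beyond R the decay 2 / |w| is stronger than required.\<close>

lemma branch_bound:
  obtains C where "C > 0" "\<And>w. Im w > 0 \<Longrightarrow> norm (branch w + of_nat k) \<le> C / sqrt (norm w)"
proof -
  obtain C where C: "C > 0" "\<And>w. Im w \<ge> 0 \<Longrightarrow> w \<noteq> 0 \<Longrightarrow> norm (branch w) \<le> C * exp (\<bar>ln (norm w)\<bar> / 2)"
    using norm_branch_le by blast
  obtain R where R: "R \<ge> 1" "\<And>w. Im w > 0 \<Longrightarrow> norm w > R \<Longrightarrow> norm (branch w + of_nat k) \<le> 2 / norm w"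
    using norm_branch_plus_k_le by blast
  define K where "K = (C + real k) * R + 2"
  show ?thesis
  proof (rule that)
    show "K > 0" using C(1) R(1) by (auto simp: K_def intro!: add_nonneg_pos)
    fix w assume w: "Im w > 0"
    then have n: "norm w > 0" by auto
    have sq: "exp (ln (norm w) / 2) = sqrt (norm w)"
      using n exp_ln[of "sqrt (norm w)"] by (simp add: ln_sqrt)
    show "norm (branch w + of_nat k) \<le> K / sqrt (norm w)"
    proof (cases "norm w > R")
      case True
      then have "norm w \<ge> 1" using R(1) by linarith
      then have "1 * sqrt (norm w) \<le> sqrt (norm w) * sqrt (norm w)" by (intro mult_right_mono) auto
      then have "sqrt (norm w) \<le> norm w" by simp
      then have "2 / norm w \<le> 2 / sqrt (norm w)" using n by (intro divide_left_mono) auto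
      also have "\<dots> \<le> K / sqrt (norm w)" using C(1) R(1) by (intro divide_right_mono) (auto simp: K_def)
      finally show ?thesis using R(2)[OF w True] by simp
    next
      case False
      have e: "exp (\<bar>ln (norm w)\<bar> / 2) * sqrt (norm w) \<le> R"
      proof (cases "norm w \<ge> 1")
        case True
        then have "exp (\<bar>ln (norm w)\<bar> / 2) * sqrt (norm w) = norm w" by (simp add: sq)
        then show ?thesis using False by simp
      next
        case False
        then have "exp (\<bar>ln (norm w)\<bar> / 2) = inverse (sqrt (norm w))"
          using n sq by (simp flip: exp_minus sq)
        then show ?thesis using n R(1) by simp
      qed
      have s: "sqrt (norm w) \<le> R"
      proof -
        have "sqrt (norm w) \<le> sqrt (R * R)" using False R(1) n
          by (intro real_sqrt_le_mono) (smt (verit) mult_le_cancel_left1)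
        then show ?thesis using R(1) by simp
      qed
      have w0: "w \<noteq> 0" using n by auto
      have "norm (branch w + of_nat k) \<le> C * exp (\<bar>ln (norm w)\<bar> / 2) + real k"
        using C(2)[OF less_imp_le[OF w] w0] norm_triangle_ineq[of "branch w" "of_nat k"] by simp
      then have "norm (branch w + of_nat k) * sqrt (norm w) \<le> (C * exp (\<bar>ln (norm w)\<bar> / 2) + real k) * sqrt (norm w)"
        by (intro mult_right_mono) auto
      also have "\<dots> = C * (exp (\<bar>ln (norm w)\<bar> / 2) * sqrt (norm w)) + real k * sqrt (norm w)"
        by (simp add: algebra_simps)
      also have "\<dots> \<le> C * R + real k * R" using e s C(1) by (intro add_mono mult_left_mono) auto
      also have "\<dots> \<le> K" by (simp add: K_def algebra_simps)
      finally show ?thesis using n by (simp add: field_simps)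
    qed
  qed
qed

section \<open>The integral representation\<close>

abbreviation density_kernel :: "complex \<Rightarrow> real \<Rightarrow> complex" where
  "density_kernel z t \<equiv> indicator (cut_interval k) t *\<^sub>R (of_real (jump_density k t) / (of_real t - z))"

text \<open>Outside the cut \<open>branch\<close> is real, so the integral over the whole line
  reduces to the cut; the exceptional point 0 is a null set.\<close>

lemma representation_upper:
  assumes z: "Im z > 0"
  shows "has_bochner_integral lborel (density_kernel z) (g_ext k z + of_nat k)"
proof -
  obtain C where C: "\<And>w. Im w > 0 \<Longrightarrow> norm (branch w + of_nat k) \<le> C / sqrt (norm w)"
    using branch_bound by blast
  have "has_bochner_integral lborel (\<lambda>t. of_real (Im (branch (of_real t) + of_nat k) / pi) / (of_real t - z)) (branch z + of_nat k)"
    by (rule upper_half_plane_Stieltjes_representation[OF _ _ C z])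
      (intro continuous_intros continuous_on_branch holomorphic_intros holomorphic_on_branch)+
  moreover have "of_real (Im (branch (of_real t) + of_nat k) / pi) / (of_real t - z) = density_kernel z t" if "t \<notin> {0}" for t
    using that branch_real[of t] jump_density_eq[of t] by (auto simp: indicator_def)
  ultimately have "has_bochner_integral lborel (density_kernel z) (branch z + of_nat k)"
    by (subst has_bochner_integral_discrete_difference[of "{0}", symmetric]) auto
  then show ?thesis using g_ext_spec(2)[OF z] by simp
qed

lemma representation_lower:
  assumes z: "Im z < 0"
  shows "has_bochner_integral lborel (density_kernel z) (g_ext k z + of_nat k)"
proof -
  have "cnj z \<in> - of_real ` cut_interval k" using z by (intro nonreal_notin_of_real_image) auto
  then have "g_ext k z = cnj (g_ext k (cnj z))" using g_ext_spec(3)[of "cnj z"] by simp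
  moreover have "has_bochner_integral lborel (density_kernel (cnj z)) (g_ext k (cnj z) + of_nat k)"
    using z by (intro representation_upper) simp
  from has_bochner_integral_bounded_linear[OF bounded_linear_cnj this]
  have "has_bochner_integral lborel (density_kernel z) (cnj (g_ext k (cnj z)) + of_nat k)"
    by (simp add: indicator_def if_distrib[of cnj] cong: if_cong)
  ultimately show ?thesis by simp
qed

text \<open>A real z off the cut is approached vertically, where \<open>g_ext\<close> is continuous;
  the kernels converge dominatedly.\<close>

lemma representation_real:
  assumes z: "z \<in> - of_real ` cut_interval k" "Im z = 0"
  shows "has_bochner_integral lborel (density_kernel z) (g_ext k z + of_nat k)"
proof -
  have ne: "of_real t - z \<noteq> 0" if "t \<in> cut_interval k" for t using that z by auto
  define z' where "z' n = z + \<i> * of_real (1 / real (Suc n))" for n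
  \<comment> \<open>Integrability of the density is known at the nonreal point i; on the compact cut
    the ratio of the two Cauchy kernels is bounded.\<close>
  have "bounded ((\<lambda>t. (of_real t - \<i>) / (of_real t - z)) ` cut_interval k)"
    using ne unfolding cut_interval_def
    by (intro compact_imp_bounded compact_continuous_image continuous_intros) auto
  then obtain M where M: "\<And>t. t \<in> cut_interval k \<Longrightarrow> norm ((of_real t - \<i>) / (of_real t - z)) \<le> M"
    unfolding bounded_iff by auto
  have i: "of_real t - \<i> \<noteq> 0" for t by (simp add: complex_eq_iff)
  have int: "integrable lborel (density_kernel \<i>)" "density_kernel \<i> \<in> borel_measurable lborel"
    using representation_upper[of \<i>] by (auto simp: has_bochner_integral_iff)
  have eq: "density_kernel z t = density_kernel \<i> t * ((of_real t - \<i>) / (of_real t - z))" for t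
    using i[of t] by (simp add: indicator_def)
  have meas: "density_kernel z \<in> borel_measurable lborel"
    unfolding eq[abs_def] using int(2) by measurable
  have intz: "integrable lborel (density_kernel z)"
  proof (rule Bochner_Integration.integrable_bound[OF _ meas])
    show "integrable lborel (\<lambda>t. density_kernel \<i> t * of_real M)" using int(1) by (intro integrable_mult_left)
    show "AE t in lborel. norm (density_kernel z t) \<le> norm (density_kernel \<i> t * of_real M)"
    proof (intro AE_I2)
      fix t
      show "norm (density_kernel z t) \<le> norm (density_kernel \<i> t * of_real M)"
      proof (cases "t \<in> cut_interval k")
        case True
        then show ?thesis unfolding eq[of t] norm_mult
          using M[OF True] by (intro mult_left_mono) auto
      qed simp
    qed
  qed
  have AEl: "AE t in lborel. (\<lambda>n. density_kernel (z' n) t) \<longlonglongrightarrow> density_kernel z t"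
  proof (intro AE_I2)
    fix t
    show "(\<lambda>n. density_kernel (z' n) t) \<longlonglongrightarrow> density_kernel z t"
    proof (cases "t \<in> cut_interval k")
      case True
      have "z' \<longlonglongrightarrow> z + \<i> * of_real 0" unfolding z'_def
        by (intro tendsto_intros LIMSEQ_Suc[OF lim_const_over_n])
      then have "z' \<longlonglongrightarrow> z" by simp
      then show ?thesis using ne[OF True] by (intro tendsto_intros)
    qed simp
  qed
  have AEb: "AE t in lborel. norm (density_kernel (z' n) t) \<le> norm (density_kernel z t)" for n
  proof (intro AE_I2)
    fix t
    show "norm (density_kernel (z' n) t) \<le> norm (density_kernel z t)"
    proof (cases "t \<in> cut_interval k")
      case True
      \<comment> \<open>A vertical shift away from the real axis only increases the distance to t,
        so the kernel at z itself is the dominating function.\<close>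
      have "norm (of_real t - z) \<le> norm (of_real t - z' n)"
        using z(2) unfolding cmod_def by (auto simp: z'_def)
      then have "norm (of_real (jump_density k t) / (of_real t - z' n)) \<le> norm (complex_of_real (jump_density k t) / (of_real t - z))"
        using ne[OF True] unfolding norm_divide by (intro divide_left_mono mult_pos_pos) (auto intro: less_le_trans[of 0 "norm (of_real t - z)"])
      with True show ?thesis by simp
    qed simp
  qed
  have z'1: "Im (z' n) > 0" for n using z(2) by (simp add: z'_def)
  have rep: "has_bochner_integral lborel (density_kernel (z' n)) (g_ext k (z' n) + of_nat k)" for n
    by (rule representation_upper[OF z'1])
  have int_n: "integrable lborel (density_kernel (z' n))" for n
    using rep[of n] by (simp add: has_bochner_integral_iff)
  have "(\<lambda>n. integral\<^sup>L lborel (density_kernel (z' n))) \<longlonglongrightarrow> integral\<^sup>L lborel (density_kernel z)"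
    by (rule integral_dominated_convergence[OF meas borel_measurable_integrable[OF int_n] integrable_norm[OF intz] AEl AEb])
  then have "(\<lambda>n. g_ext k (z' n) + of_nat k) \<longlonglongrightarrow> integral\<^sup>L lborel (density_kernel z)"
    using has_bochner_integral_integral_eq[OF rep] by simp
  moreover have "(\<lambda>n. g_ext k (z' n) + of_nat k) \<longlonglongrightarrow> g_ext k z + of_nat k"
  proof (intro tendsto_intros continuous_on_tendsto_compose[OF holomorphic_on_imp_continuous_on[OF g_ext_spec(1)] _ z(1)])
    have "z' \<longlonglongrightarrow> z + \<i> * of_real 0" unfolding z'_def
      by (intro tendsto_intros LIMSEQ_Suc[OF lim_const_over_n])
    then show "z' \<longlonglongrightarrow> z" by simp
    show "\<forall>\<^sub>F n in sequentially. z' n \<in> - of_real ` cut_interval k"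
      using z'1 by (intro always_eventually allI nonreal_notin_of_real_image) (simp add: less_imp_neq[THEN not_sym])
  qed
  ultimately have "integral\<^sup>L lborel (density_kernel z) = g_ext k z + of_nat k" by (rule LIMSEQ_unique)
  with intz show ?thesis by (simp add: has_bochner_integral_iff)
qed

end

theorem theorem4p3:
  fixes k :: nat and z :: complex
  assumes "odd k" and "k \<ge> 1"
    and "z \<in> - of_real ` cut_interval k"
  shows "set_integrable lborel {Gamma (crit_pt k)..Gamma (crit_pt (k + 1))}
           (\<lambda>t. of_real (jump_density k t) / (of_real t - z))
       \<and> g_ext k z =
           (LINT t:{Gamma (crit_pt k)..Gamma (crit_pt (k + 1))}|lborel.
              of_real (jump_density k t) / (of_real t - z)) - of_nat k"
proof -
  interpret odd_branch k by unfold_locales (rule assms(1))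
  have "has_bochner_integral lborel (density_kernel z) (g_ext k z + of_nat k)"
    using representation_upper[of z] representation_lower[of z] representation_real[OF assms(3)]
    by (cases "Im z" "0 :: real" rule: linorder_cases) auto
  then show ?thesis
    unfolding set_integrable_def set_lebesgue_integral_def cut_interval_def[symmetric]
    by (simp add: has_bochner_integral_iff)
qed

end
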